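(* Let $\Bbbk$ be an algebraically closed field of characteristic $2$, and let $G\leq \mathrm{GL}_7(\mathbb F_2)$ be the group of all matrices \[\begin{pmatrix} I_4 & 0\\ A(\alpha) & I_3\end{pmatrix},\qquad A(\alpha)=\begin{pmatrix}\alpha_1&0&0&\alpha_4\\0&\alpha_2&0&\alpha_4\\0&0&\alpha_3&\alpha_4\end{pmatrix},\qquad \alpha_1,\dots,\alpha_4\in\mathbb F_2,\] acting on $V=\Bbbk^7$ with coordinate functions $x_1,\dots,x_7$. Let $x_1,x_2,x_3,x_4,f_1,f_2,f_3,g_1,g_2,g_3,r$ be the minimal generating set of $\Bbbk[V]^G$ described in the context. Then the invariants \[x_1,\ x_2,\ x_3,\ x_4,\ f_1,\ f_2,\ g_1,\ g_2,\ f_3+g_3\] form a separating set for $\Bbbk[V]^G$ of minimal size.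
   Context: $I_m$ is the $m\times m$ identity matrix. $\Bbbk[V]=\operatorname{Sym}(V^* )=\Bbbk[x_1,\dots,x_7]$ carries the induced action of $G$, and $\Bbbk[V]^G$ is the ring of invariants. A separating set is a subset $E\subset\Bbbk[V]^G$ such that whenever $v,w\in V$ have distinct $G$-orbits there is $h\in E$ with $h(v)\neq h(w)$; it is of minimal size if no separating set has fewer elements. The ring of invariants has a minimal generating set $\Bbbk[V]^G=\Bbbk[x_1,x_2,x_3,x_4,f_1,f_2,f_3,g_1,g_2,g_3,r]$ with $f_i,g_i,r$ homogeneous, $\deg f_i=3$, $\deg g_i=4$, $\deg r=5$, satisfying the following relations (verified by computer algebra): (a) $f_i r\in\Bbbk[x_1,x_2,x_3,x_4,f_1,f_2,f_3,g_1,g_2,g_3]$ for $i=1,2,3$; (b) $r^2\equiv (x_1+x_4)^2g_2g_3 \bmod (f_1,f_2,f_3)$; (c) $(x_3+x_4)f_3=f_2(x_2+x_4)+f_1(x_1+x_4)$; (d) $(x_2+x_4)^2g_3\equiv f_1^2$ and $(x_1+x_4)^2g_3\equiv f_2^2 \bmod (x_3+x_4)$; (e) $f_3\equiv 0 \bmod (x_1+x_4,\,x_2+x_4,\,x_3+x_4)$. The $f_i,g_i,r$ in the claim are these generators. *)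

theory Defs
  imports
    "HOL-Analysis.Cartesian_Space"
    "HOL-Computational_Algebra.Polynomial"
    "HOL-Library.Numeral_Type"
    "HOL-Library.Poly_Mapping"
    "HOL-Library.Z2"
begin

section \<open>Polynomials on \<open>V = k\<^sup>n\<close>\<close>

text \<open>
  \<open>('k, 'n) mpoly\<close> is \<open>k[x\<^sub>i | i : 'n]\<close>, as finitely supported functions from exponent
  vectors to coefficients with the convolution product.
\<close>

type_synonym ('k, 'n) mpoly = "('n \<Rightarrow>\<^sub>0 nat) \<Rightarrow>\<^sub>0 'k"

definition Const :: "'k::comm_semiring_1 \<Rightarrow> ('k, 'n) mpoly" where
  "Const c = Poly_Mapping.single 0 c"

definition X :: "'n \<Rightarrow> ('k::comm_semiring_1, 'n) mpoly" where
  "X i = Poly_Mapping.single (Poly_Mapping.single i 1) 1"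

text \<open>The image of a polynomial under \<open>c\<close> on coefficients and \<open>x\<^sub>i \<mapsto> h i\<close>.\<close>

definition poly_subst ::
  "('k::comm_semiring_1 \<Rightarrow> 'r::comm_semiring_1) \<Rightarrow> ('n::finite \<Rightarrow> 'r) \<Rightarrow> ('k, 'n) mpoly \<Rightarrow> 'r" where
  "poly_subst c h p =
     (\<Sum>m\<in>Poly_Mapping.keys p. c (Poly_Mapping.lookup p m) * (\<Prod>i\<in>UNIV. h i ^ Poly_Mapping.lookup m i))"

definition peval :: "('k::comm_semiring_1, 'n::finite) mpoly \<Rightarrow> 'k ^ 'n \<Rightarrow> 'k" where
  "peval p v = poly_subst (\<lambda>c. c) (\<lambda>i. v $ i) p"

definition homogeneous :: "nat \<Rightarrow> ('k::comm_semiring_1, 'n::finite) mpoly \<Rightarrow> bool" where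
  "homogeneous d p \<longleftrightarrow>
     (\<forall>m\<in>Poly_Mapping.keys p. (\<Sum>i\<in>UNIV. Poly_Mapping.lookup m i) = d)"

text \<open>The \<open>k\<close>-subalgebra generated by a set of polynomials.\<close>

inductive_set subalgebra :: "('k::comm_ring_1, 'n) mpoly set \<Rightarrow> ('k, 'n) mpoly set"
  for S :: "('k, 'n) mpoly set" where
  gen: "p \<in> S \<Longrightarrow> p \<in> subalgebra S"
| const: "Const c \<in> subalgebra S"
| add: "p \<in> subalgebra S \<Longrightarrow> q \<in> subalgebra S \<Longrightarrow> p + q \<in> subalgebra S"
| mult: "p \<in> subalgebra S \<Longrightarrow> q \<in> subalgebra S \<Longrightarrow> p * q \<in> subalgebra S"

definition minimal_generating_set ::
  "('k::comm_ring_1, 'n) mpoly set \<Rightarrow> ('k, 'n) mpoly set \<Rightarrow> bool" where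
  "minimal_generating_set R S \<longleftrightarrow> subalgebra S = R \<and> (\<forall>T. T \<subset> S \<longrightarrow> subalgebra T \<noteq> R)"

text \<open>
  Congruence modulo the ideal generated by \<open>S\<close> in the whole polynomial ring \<open>k[V]\<close>.
  (For invariants this is implied by congruence modulo the ideal generated in \<open>k[V]\<^sup>G\<close>.)
\<close>

definition cong_mod_ideal ::
  "('k::comm_ring_1, 'n) mpoly \<Rightarrow> ('k, 'n) mpoly \<Rightarrow> ('k, 'n) mpoly set \<Rightarrow> bool" where
  "cong_mod_ideal p q S \<longleftrightarrow> p - q \<in> module.span (*) S"


section \<open>Matrix groups over \<open>F\<^sub>2\<close> acting on \<open>V\<close> and \<open>k[V]\<close>\<close>

text \<open>
  Entrywise extension of scalars from \<open>F\<^sub>2\<close> (type \<^typ>\<open>bit\<close>) to \<open>k\<close>;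
  it is multiplicative when \<open>k\<close> has characteristic 2.
\<close>

definition extend_scalars :: "bit ^ 'n ^ 'm \<Rightarrow> 'k::comm_ring_1 ^ 'n ^ 'm" where
  "extend_scalars g = (\<chi> i j. of_bit (g $ i $ j))"

definition orbit :: "(bit ^ 'n ^ 'n) set \<Rightarrow> ('k::comm_ring_1) ^ 'n \<Rightarrow> ('k ^ 'n) set" where
  "orbit G v = {extend_scalars g *v v | g. g \<in> G}"

text \<open>The induced action \<open>(g \<cdot> p)(v) = p(g\<^sup>-\<^sup>1 v)\<close> on \<open>k[V] = Sym(V\<^sup>*)\<close>.\<close>

definition poly_act ::
  "bit ^ 'n ^ 'n \<Rightarrow> ('k::comm_ring_1, 'n::finite) mpoly \<Rightarrow> ('k, 'n) mpoly" where
  "poly_act g = poly_subst Const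
     (\<lambda>i. \<Sum>j\<in>UNIV. Const (extend_scalars (matrix_inv g) $ i $ j) * X j)"

definition invariants :: "(bit ^ 'n ^ 'n) set \<Rightarrow> ('k::comm_ring_1, 'n::finite) mpoly set" where
  "invariants G = {p. \<forall>g\<in>G. poly_act g p = p}"

definition separating_set ::
  "(bit ^ 'n ^ 'n) set \<Rightarrow> ('k::comm_ring_1, 'n::finite) mpoly set \<Rightarrow> bool" where
  "separating_set G E \<longleftrightarrow> E \<subseteq> invariants G \<and>
     (\<forall>v w. orbit G v \<noteq> orbit G w \<longrightarrow> (\<exists>h\<in>E. peval h v \<noteq> peval h w))"

definition separating_set_of_minimal_size ::
  "(bit ^ 'n ^ 'n) set \<Rightarrow> ('k::comm_ring_1, 'n::finite) mpoly set \<Rightarrow> bool" where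
  "separating_set_of_minimal_size G E \<longleftrightarrow> separating_set G E \<and> finite E \<and>
     (\<forall>F :: ('k, 'n) mpoly set. separating_set G F \<and> finite F \<longrightarrow> card E \<le> card F)"


section \<open>The group \<open>G\<close>\<close>

text \<open>
  Rows and columns are indexed by \<open>1, \<dots>, 7\<close> of the numeral type \<open>7\<close> (in which \<open>7 = 0\<close>).
\<close>

definition G_mat :: "bit \<Rightarrow> bit \<Rightarrow> bit \<Rightarrow> bit \<Rightarrow> bit ^ 7 ^ 7" where
  "G_mat a1 a2 a3 a4 = vector
    [vector [1,  0,  0,  0,  0, 0, 0],
     vector [0,  1,  0,  0,  0, 0, 0],
     vector [0,  0,  1,  0,  0, 0, 0],
     vector [0,  0,  0,  1,  0, 0, 0],
     vector [a1, 0,  0,  a4, 1, 0, 0],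
     vector [0,  a2, 0,  a4, 0, 1, 0],
     vector [0,  0,  a3, a4, 0, 0, 1]]"

definition G :: "(bit ^ 7 ^ 7) set" where
  "G = {G_mat a1 a2 a3 a4 | a1 a2 a3 a4. True}"

end

theory Submission
  imports Defs
begin

text \<open>
  Separation: outside \<open>x3 = x4\<close> the value of \<open>f3\<close> is determined by relation (c), on \<open>x3 = x4\<close> either \<open>g3\<close> is
  determined by (d) or \<open>f3 = 0\<close> by (e), so \<open>f3 + g3\<close> suffices to recover both. Then \<open>r\<close> is determined by
  (a) where some \<open>f i\<close> is nonzero and by (b) elsewhere, square roots being unique in characteristic 2.

  Minimality: near a point \<open>v0\<close> with \<open>x1 = x2 = x3 = x4 = 1\<close>, whose stabiliser is generated by an element
  \<open>\<sigma>\<close> with fixed space of codimension 3, the set of pairs \<open>(v, w)\<close> in a common orbit is the union of the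
  graphs of \<open>1\<close> and \<open>\<sigma>\<close>, and these meet in codimension 3. By a connectedness argument in
  the style of Hartshorne and Grothendieck it is not cut out by 8 equations \<open>h j v = h j w\<close>. Seven general
  ones of them form a regular sequence together with the equations \<open>x i = x4\<close> of the fixed space of \<open>\<sigma>\<close>; the idempotent
  that separates the two graphs away from their intersection would, by the vanishing of Koszul homology,
  extend to the intersection.
\<close>

section \<open>Evaluation of polynomials\<close>

text \<open>The numbers fit as follows. Restricting \<open>v\<close> to a 3-dimensional slice
  transverse to the fixed space of the stabiliser turns pairs \<open>(w, v)\<close> into points of a
  space of dimension 7 + 3 = 10, in which the two graphs are 3-dimensional and meet in one point. By
  Grothendieck, 8 equations in a 10-dimensional regular local ring cut out a set that stays
  connected without its closed point; these two graphs do not. With 9 equations this obstruction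
  disappears.

  Seven of the equations are projected ones, chosen to have finite fibres; together with the 3 slice
  equations they isolate the point, so modulo them the local ring has depth 3. The eighth equation,
  \<delta>, is treated separately: the idempotent exists only modulo \<delta>. Its coboundary is
  \<delta> times a 1-cocycle, which depth 3 makes a coboundary; the section so corrected then
  extends over the point. Its values there along the two graphs would be 0 and 1.

  Localisation at the point appears only as factors \<open>q ^ m\<close>, with \<open>q\<close>
  nonzero there. Nilpotents from the Nullstellensatz are absorbed into exponents
  \<open>2 ^ n\<close>, because such powers are additive in characteristic 2.\<close>

locale cring_hom =
  fixes H :: "'a::comm_ring_1 \<Rightarrow> 'b::comm_ring_1"
  assumes hom_1 [simp]: "H 1 = 1"
    and hom_add [simp]: "H (x + y) = H x + H y"
    and hom_mult [simp]: "H (x * y) = H x * H y"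
begin

lemma hom_0 [simp]: "H 0 = 0"
  using hom_add[of 0 0] by (metis add_0 add_cancel_right_right)

lemma hom_uminus [simp]: "H (- x) = - H x"
  using hom_add[of x "- x"] by (simp add: add_eq_0_iff)

lemma hom_diff [simp]: "H (x - y) = H x - H y"
  using hom_add[of x "- y"] by simp

lemma hom_power [simp]: "H (x ^ n) = H x ^ n"
  by (induction n) simp_all

lemma hom_sum [simp]: "H (sum f S) = (\<Sum>i\<in>S. H (f i))"
  by (induction S rule: infinite_finite_induct) simp_all

lemma hom_prod [simp]: "H (prod f S) = (\<Prod>i\<in>S. H (f i))"
  by (induction S rule: infinite_finite_induct) simp_all

lemma hom_poly_subst: "H (poly_subst c h p) = poly_subst (\<lambda>x. H (c x)) (\<lambda>i. H (h i)) p"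
  by (simp add: poly_subst_def)

end

lemma cring_hom_id: "cring_hom (\<lambda>x. x)"
  by unfold_locales auto

lemma mpoly_monomials: "(\<Sum>m\<in>Poly_Mapping.keys p. Poly_Mapping.single m (Poly_Mapping.lookup p m)) = p"
  by (rule poly_mapping_eqI)
    (simp add: lookup_sum lookup_single when_def sum.delta in_keys_iff)

lemma poly_subst_superset:
  assumes "c 0 = 0" "finite S" "Poly_Mapping.keys p \<subseteq> S"
  shows "poly_subst c h p = (\<Sum>m\<in>S. c (Poly_Mapping.lookup p m) * (\<Prod>i\<in>UNIV. h i ^ Poly_Mapping.lookup m i))"
  unfolding poly_subst_def
  by (rule sum.mono_neutral_left) (use assms in \<open>auto simp: in_keys_iff\<close>)

lemma poly_subst_single:
  assumes "c 0 = 0"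
  shows "poly_subst c h (Poly_Mapping.single m a) = c a * (\<Prod>i\<in>UNIV. h i ^ Poly_Mapping.lookup m i)"
  by (subst poly_subst_superset[where S = "{m}"]) (use assms in auto)

lemma poly_subst_add:
  assumes "c 0 = 0" "\<And>a b. c (a + b) = c a + c b"
  shows "poly_subst c h (p + q) = poly_subst c h p + poly_subst c h q"
proof -
  let ?S = "Poly_Mapping.keys p \<union> Poly_Mapping.keys q"
  note * = poly_subst_superset[where S = ?S and c = c and h = h, OF assms(1)]
  show ?thesis
    using keys_add[of p q]
    by (simp add: * assms lookup_add distrib_right sum.distrib)
qed

lemma cring_hom_poly_subst:
  assumes "cring_hom c"
  shows "cring_hom (poly_subst c h)"
proof -
  interpret c: cring_hom c by fact
  note add = poly_subst_add[OF c.hom_0 c.hom_add]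
  have zero: "poly_subst c h 0 = 0" by (simp add: poly_subst_def)
  have sum: "poly_subst c h (sum f S) = (\<Sum>i\<in>S. poly_subst c h (f i))" for f and S :: "'i set"
    by (induction S rule: infinite_finite_induct) (simp_all add: zero add)
  have single: "poly_subst c h (Poly_Mapping.single m a * Poly_Mapping.single n b)
     = poly_subst c h (Poly_Mapping.single m a) * poly_subst c h (Poly_Mapping.single n b)" for m n a b
    by (simp add: mult_single poly_subst_single lookup_add power_add prod.distrib)
  have mult: "poly_subst c h (p * q) = poly_subst c h p * poly_subst c h q" for p q
  proof -
    let ?s = "\<lambda>p m. Poly_Mapping.single m (Poly_Mapping.lookup p m)"
    let ?P = "Poly_Mapping.keys p" and ?Q = "Poly_Mapping.keys q"
    have "p * q = (\<Sum>m\<in>?P. \<Sum>n\<in>?Q. ?s p m * ?s q n)"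
      by (simp only: sum_product[symmetric] mpoly_monomials)
    then have "poly_subst c h (p * q)
        = (\<Sum>m\<in>?P. \<Sum>n\<in>?Q. poly_subst c h (?s p m) * poly_subst c h (?s q n))"
      by (simp add: local.sum single)
    also have "\<dots> = (\<Sum>m\<in>?P. poly_subst c h (?s p m)) * (\<Sum>n\<in>?Q. poly_subst c h (?s q n))"
      by (simp add: sum_product)
    also have "\<dots> = poly_subst c h p * poly_subst c h q"
      by (simp only: local.sum[symmetric] mpoly_monomials)
    finally show ?thesis .
  qed
  show ?thesis
    by unfold_locales (simp_all add: add mult poly_subst_single flip: single_one)
qed

lemma cring_hom_Const: "cring_hom (Const :: 'k::comm_ring_1 \<Rightarrow> ('k, 'n) mpoly)"
  by unfold_locales (simp_all add: Const_def single_add mult_single)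

lemma poly_subst_Const: "c 0 = 0 \<Longrightarrow> poly_subst c h (Const a) = c a"
  by (simp add: Const_def poly_subst_single)

lemma poly_subst_X:
  assumes "c 0 = 0" "c 1 = 1"
  shows "poly_subst c h (X i) = h i"
proof -
  have "(\<Prod>j\<in>UNIV. h j ^ Poly_Mapping.lookup (Poly_Mapping.single i 1) j) = (\<Prod>j\<in>UNIV. if j = i then h i else 1)"
    by (intro prod.cong) (auto simp: lookup_single)
  then show ?thesis
    using assms by (simp add: X_def poly_subst_single)
qed

interpretation peval: cring_hom "\<lambda>p. peval p v" for v :: "'k::comm_ring_1 ^ 'n"
  unfolding peval_def by (intro cring_hom_poly_subst cring_hom_id)

interpretation Const: cring_hom Const
  by (rule cring_hom_Const)

lemma peval_Const [simp]: "peval (Const c) v = c"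
  by (simp add: peval_def poly_subst_Const)

lemma peval_X [simp]: "peval (X i) v = v $ i"
  by (simp add: peval_def poly_subst_X)

lemma peval_poly_subst:
  fixes p :: "('k::comm_ring_1, 'n::finite) mpoly"
  shows "peval (poly_subst Const h p) v = peval p (\<chi> i. peval (h i) v)"
  by (simp add: peval.hom_poly_subst) (simp add: peval_def)

lemma subalgebra_peval_eq:
  assumes "p \<in> subalgebra S" "\<And>q. q \<in> S \<Longrightarrow> peval q v = peval q w"
  shows "peval p v = peval p w"
  using assms(1) by induction (simp_all add: assms(2))

lemma X_power: "X i ^ k = Poly_Mapping.single (Poly_Mapping.single i k) 1"
  by (induction k) (simp_all add: X_def mult_single single_add[symmetric])

lemma hom_mpoly_eq:
  assumes "cring_hom H" "cring_hom K"
    and "\<And>c. H (Const c) = K (Const c)" "\<And>i. H (X i) = K (X i)"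
  shows "H (p :: ('k::comm_ring_1, 'n::finite) mpoly) = K p"
proof -
  interpret H: cring_hom H by fact
  interpret K: cring_hom K by fact
  have "Poly_Mapping.single m a = Const a * (\<Prod>i\<in>UNIV. X i ^ Poly_Mapping.lookup m i)"
    for m :: "'n \<Rightarrow>\<^sub>0 nat" and a :: 'k
  proof -
    have prod: "(\<Prod>i\<in>S. X i ^ Poly_Mapping.lookup m i)
       = Poly_Mapping.single (\<Sum>i\<in>S. Poly_Mapping.single i (Poly_Mapping.lookup m i)) (1::'k)" for S
      by (induction S rule: infinite_finite_induct) (simp_all add: X_power mult_single)
    have "(\<Sum>i\<in>UNIV. Poly_Mapping.single i (Poly_Mapping.lookup m i)) = m"
      by (rule poly_mapping_eqI) (simp add: lookup_sum lookup_single when_def)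
    then show ?thesis
      by (simp add: prod Const_def mult_single)
  qed
  then have "H (Poly_Mapping.single m a) = K (Poly_Mapping.single m a)" for m a
    by (simp add: assms)
  then show ?thesis
    by (subst (1 2) mpoly_monomials[of p, symmetric]) (simp only: H.hom_sum K.hom_sum)
qed

lemma poly_subst_Const_X:
  fixes p :: "('k::comm_ring_1, 'n::finite) mpoly"
  shows "poly_subst Const X p = p"
  by (rule hom_mpoly_eq[where H = "poly_subst Const X" and K = "\<lambda>p. p"])
    (simp_all add: cring_hom_poly_subst cring_hom_Const cring_hom_id poly_subst_Const poly_subst_X)

section \<open>Hilbert's Nullstellensatz\<close>

interpretation ideal: module "(*) :: 'a::comm_ring_1 \<Rightarrow> 'a \<Rightarrow> 'a"
  by unfold_locales (simp_all add: algebra_simps)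

declare ideal.scale_scale [simp del]

definition prime_ideal :: "'a::comm_ring_1 set \<Rightarrow> bool" where
  "prime_ideal P \<longleftrightarrow> ideal.subspace P \<and> 1 \<notin> P \<and> (\<forall>x y. x * y \<in> P \<longrightarrow> x \<in> P \<or> y \<in> P)"

lemma prime_ideal_power: "prime_ideal P \<Longrightarrow> x ^ n \<in> P \<Longrightarrow> x \<in> P"
  by (induction n) (auto simp: prime_ideal_def)

text \<open>By Zorn there is a maximal ideal among those avoiding the powers of \<open>u\<close>.
  Adjoining an outside element puts a power of \<open>u\<close> into it; for two outside elements
  whose product lies inside, multiplying the two relations gives a power of \<open>u\<close>
  inside.\<close>

lemma prime_ideal_avoiding_powers:
  assumes I: "ideal.subspace I" and u: "\<And>n. u ^ n \<notin> I"
  obtains P where "prime_ideal P" "I \<subseteq> P" "u \<notin> P"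
proof -
  let ?A = "{J. ideal.subspace J \<and> I \<subseteq> J \<and> (\<forall>n. u ^ n \<notin> J)}"
  have "\<exists>M\<in>?A. \<forall>J\<in>?A. M \<subseteq> J \<longrightarrow> J = M"
  proof (rule subset_Zorn_nonempty)
    show "?A \<noteq> {}" using assms by blast
    fix C assume C: "C \<noteq> {}" "subset.chain ?A C"
    have "C \<subseteq> ?A" using C(2) by (auto simp: subset_chain_def)
    then have sub: "ideal.subspace J" and sub': "I \<subseteq> J \<and> (\<forall>n. u ^ n \<notin> J)" if "J \<in> C" for J
      using that by auto
    have "ideal.subspace (\<Union>C)"
    proof (rule ideal.subspaceI)
      show "0 \<in> \<Union>C" using C(1) sub ideal.subspace_0 by blast
      show "x + y \<in> \<Union>C" if xy: "x \<in> \<Union>C" "y \<in> \<Union>C" for x y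
      proof -
        from xy obtain J K where JK: "J \<in> C" "K \<in> C" "x \<in> J" "y \<in> K" by blast
        then consider "J \<subseteq> K" | "K \<subseteq> J" using C(2) by (auto simp: subset_chain_def)
        then show ?thesis
          using JK sub by cases (meson UnionI ideal.subspace_add subsetD)+
      qed
      show "c * x \<in> \<Union>C" if "x \<in> \<Union>C" for c x
        using that sub ideal.subspace_scale by blast
    qed
    moreover have "I \<subseteq> \<Union>C"
    proof -
      from C(1) obtain J where "J \<in> C" by blast
      then show ?thesis using sub' by blast
    qed
    moreover have "\<forall>n. u ^ n \<notin> \<Union>C"
      using sub' by auto
    ultimately show "\<Union>C \<in> ?A" by blast
  qed
  then obtain M where "M \<in> ?A" and max': "\<forall>J\<in>?A. M \<subseteq> J \<longrightarrow> J = M" ..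
  then have M: "ideal.subspace M" "I \<subseteq> M" "\<And>n. u ^ n \<notin> M" by simp_all
  have max: "J = M" if "ideal.subspace J" "\<forall>n. u ^ n \<notin> J" "M \<subseteq> J" for J
    using max' that M(2) by simp
  have span: "ideal.span M = M" using M(1) by (simp add: ideal.span_eq_iff)
  have adjoin: "\<exists>n k. u ^ n - k * x \<in> M" if "x \<notin> M" for x
  proof -
    let ?J = "ideal.span (insert x M)"
    have "M \<subseteq> ?J" "x \<in> ?J" by (auto intro: ideal.span_base)
    then have "\<not> (\<forall>n. u ^ n \<notin> ?J)"
      using max[OF ideal.subspace_span] that by metis
    then show ?thesis
      by (auto simp: ideal.span_insert span)
  qed
  have "x \<in> M \<or> y \<in> M" if xy: "x * y \<in> M" for x y
  proof (rule ccontr)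
    assume "\<not> (x \<in> M \<or> y \<in> M)"
    then obtain a b k l where ab: "u ^ a - k * x \<in> M" "u ^ b - l * y \<in> M"
      using adjoin by meson
    note Padd = ideal.subspace_add[OF M(1)] and Pmul = ideal.subspace_scale[OF M(1)]
    have "u ^ b * (u ^ a - k * x) + (k * x) * (u ^ b - l * y) + k * l * (x * y) \<in> M"
      by (rule Padd[OF Padd[OF Pmul[OF ab(1)] Pmul[OF ab(2)]] Pmul[OF xy]])
    moreover have "U * (W - k * x) + (k * x) * (U - l * y) + k * l * (x * y) = W * U" for U W
      by (simp add: algebra_simps)
    ultimately have "u ^ (a + b) \<in> M" by (simp only: power_add)
    then show False using M(3) by simp
  qed
  then have "prime_ideal M"
    using M(1) M(3)[of 0] by (auto simp: prime_ideal_def)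
  then show ?thesis using that M(2) M(3)[of 1] by auto
qed

section \<open>Subrings, polynomials over them, and extension of homomorphisms\<close>

definition subring :: "'a::comm_ring_1 set \<Rightarrow> bool" where
  "subring A \<longleftrightarrow> 1 \<in> A \<and> (\<forall>x\<in>A. \<forall>y\<in>A. x - y \<in> A \<and> x * y \<in> A)"

lemma subringD:
  assumes "subring A"
  shows "1 \<in> A" "0 \<in> A" "x \<in> A \<Longrightarrow> y \<in> A \<Longrightarrow> x - y \<in> A" "x \<in> A \<Longrightarrow> y \<in> A \<Longrightarrow> x * y \<in> A"
    "x \<in> A \<Longrightarrow> - x \<in> A" "x \<in> A \<Longrightarrow> y \<in> A \<Longrightarrow> x + y \<in> A" "x \<in> A \<Longrightarrow> x ^ n \<in> A"
proof -
  show 1: "1 \<in> A" and diff: "x \<in> A \<Longrightarrow> y \<in> A \<Longrightarrow> x - y \<in> A"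
    and mult: "x \<in> A \<Longrightarrow> y \<in> A \<Longrightarrow> x * y \<in> A" for x y
    using assms by (auto simp: subring_def)
  show 0: "0 \<in> A" using diff[OF 1 1] by simp
  show minus: "x \<in> A \<Longrightarrow> - x \<in> A" for x using diff[OF 0, of x] by simp
  show "x \<in> A \<Longrightarrow> y \<in> A \<Longrightarrow> x + y \<in> A" using diff[OF _ minus, of x y] by simp
  show "x \<in> A \<Longrightarrow> x ^ n \<in> A" by (induction n) (use 1 mult in auto)
qed

lemma subring_sum:
  assumes "subring A" "\<And>i. i \<in> S \<Longrightarrow> f i \<in> A"
  shows "sum f S \<in> A"
  using assms(2) by (induction S rule: infinite_finite_induct) (auto intro: subringD[OF assms(1)])

lemma subring_prod:
  assumes "subring A" "\<And>i. i \<in> S \<Longrightarrow> f i \<in> A"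
  shows "prod f S \<in> A"
  using assms(2) by (induction S rule: infinite_finite_induct) (auto intro: subringD[OF assms(1)])

definition polys_over :: "'a::comm_ring_1 set \<Rightarrow> 'a poly set" where
  "polys_over A = {p. \<forall>n. coeff p n \<in> A}"

definition adjoin :: "'a::comm_ring_1 set \<Rightarrow> 'a \<Rightarrow> 'a set" where
  "adjoin A z = {poly p z | p. p \<in> polys_over A}"

lemma polys_overD: "p \<in> polys_over A \<Longrightarrow> coeff p n \<in> A"
  by (simp add: polys_over_def)

lemma subring_polys_over:
  assumes "subring A"
  shows "subring (polys_over A)"
  using assms unfolding subring_def[of "polys_over A"]
  by (auto simp: polys_over_def coeff_mult intro!: subringD subring_sum)

lemma monom_polys_over: "subring A \<Longrightarrow> c \<in> A \<Longrightarrow> monom c n \<in> polys_over A"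
  by (auto simp: polys_over_def intro: subringD)

lemma smult_polys_over: "subring A \<Longrightarrow> c \<in> A \<Longrightarrow> p \<in> polys_over A \<Longrightarrow> smult c p \<in> polys_over A"
  by (auto simp: polys_over_def intro: subringD)

lemma subring_adjoin:
  assumes "subring A"
  shows "subring (adjoin A z)"
proof -
  have "1 \<in> polys_over A" by (rule subringD[OF subring_polys_over[OF assms]])
  then have "poly 1 z \<in> adjoin A z" unfolding adjoin_def by blast
  moreover have "poly p z - poly q z \<in> adjoin A z \<and> poly p z * poly q z \<in> adjoin A z"
    if "p \<in> polys_over A" "q \<in> polys_over A" for p q
    using that subringD(3,4)[OF subring_polys_over[OF assms]] unfolding adjoin_def
    by (metis (mono_tags, lifting) mem_Collect_eq poly_diff poly_mult)
  ultimately show ?thesis by (auto simp: subring_def adjoin_def)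
qed

lemma adjoin_superset: "subring A \<Longrightarrow> A \<subseteq> adjoin A z"
  unfolding adjoin_def using monom_polys_over[of A _ 0] by (auto simp: monom_0 intro!: exI[of _ "[:_:]"])

lemma adjoin_mem: "subring A \<Longrightarrow> z \<in> adjoin A z"
  unfolding adjoin_def using monom_polys_over[OF _ subringD(1), of A 1]
  by (auto simp: poly_monom intro!: exI[of _ "monom 1 1"])

text \<open>The leading coefficient of \<open>m\<close> need not be a unit of \<open>A\<close>, so
  \<open>p\<close> is first multiplied by a power of it. The degree bound on the quotient serves to
  compare it with a minimal polynomial.\<close>

lemma pseudo_division:
  assumes A: "subring A" and m: "m \<in> polys_over A" "degree m > 0" and p: "p \<in> polys_over A"
  shows "\<exists>s c r. smult (lead_coeff m ^ s) p = m * c + r \<and> c \<in> polys_over A \<and> r \<in> polys_over A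
           \<and> degree r < degree m \<and> degree c \<le> degree p - degree m"
  using p
proof (induction "degree p" arbitrary: p rule: less_induct)
  case less
  note AT = subringD[OF subring_polys_over[OF A]]
  let ?a = "lead_coeff m" and ?n = "degree p" and ?d = "degree m"
  show ?case
  proof (cases "?n < ?d")
    case True
    then show ?thesis
      using less.prems AT by (intro exI[of _ 0] exI[of _ 0] exI[of _ p]) auto
  next
    case False
    let ?t = "monom (lead_coeff p) (?n - ?d)"
    let ?p = "smult ?a p - ?t * m"
    have t: "?t \<in> polys_over A"
      by (intro monom_polys_over A polys_overD less.prems)
    have coeffs: "coeff ?p k = 0" if "k \<ge> ?n" for k
    proof (cases "k = ?n")
      case True
      then show ?thesis using False by (simp add: coeff_monom_mult)
    next
      case 2: False
      then show ?thesis using that False by (simp add: coeff_monom_mult coeff_eq_0)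
    qed
    have "degree ?p < ?n"
      using coeffs False m(2) by (metis leI leading_coeff_0_iff degree_0 le_zero_eq not_gr_zero)
    moreover have "?p \<in> polys_over A"
      by (intro AT(3,4) smult_polys_over A polys_overD less.prems m t)
    ultimately obtain s c r where s: "smult (?a ^ s) ?p = m * c + r" "c \<in> polys_over A"
      "r \<in> polys_over A" "degree r < ?d" "degree c \<le> degree ?p - ?d"
      using less.hyps by blast
    let ?c = "c + smult (?a ^ s) ?t"
    have "smult (?a ^ Suc s) p = smult (?a ^ s) ?p + smult (?a ^ s) ?t * m"
      by (simp add: smult_diff_right mult.commute)
    also have "\<dots> = m * c + r + smult (?a ^ s) ?t * m" by (simp only: s(1))
    also have "\<dots> = m * ?c + r" by (simp only: distrib_left ac_simps)
    finally have "smult (?a ^ Suc s) p = m * ?c + r" .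
    moreover have "?c \<in> polys_over A"
      by (intro AT(6) s smult_polys_over A t subringD(7)[OF A] polys_overD m)
    moreover have "degree ?c \<le> ?n - ?d"
    proof (rule degree_add_le)
      show "degree c \<le> ?n - ?d" using s(5) \<open>degree ?p < ?n\<close> by linarith
      show "degree (smult (?a ^ s) ?t) \<le> ?n - ?d"
        by (rule order_trans[OF degree_smult_le degree_monom_le])
    qed
    ultimately show ?thesis using s by blast
  qed
qed

text \<open>Encodes a ring homomorphism on the image of \<open>A\<close> in the quotient ring by
  \<open>P\<close>, without forming that quotient.\<close>

definition hom_on :: "('a::comm_ring_1 \<Rightarrow> 'k::field) \<Rightarrow> 'a set \<Rightarrow> 'a set \<Rightarrow> bool" where
  "hom_on \<phi> A P \<longleftrightarrow> \<phi> 1 = 1 \<and> (\<forall>x\<in>A. \<forall>y\<in>A. \<phi> (x + y) = \<phi> x + \<phi> y \<and> \<phi> (x * y) = \<phi> x * \<phi> y)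
     \<and> (\<forall>x\<in>A \<inter> P. \<phi> x = 0)"

lemma hom_on_poly:
  assumes "hom_on \<phi> A P" "subring A" "ideal.subspace P"
  shows "\<phi> 0 = 0"
    and "coeff (map_poly \<phi> p) n = \<phi> (coeff p n)"
    and "p \<in> polys_over A \<Longrightarrow> q \<in> polys_over A \<Longrightarrow> map_poly \<phi> (p + q) = map_poly \<phi> p + map_poly \<phi> q"
    and "p \<in> polys_over A \<Longrightarrow> q \<in> polys_over A \<Longrightarrow> map_poly \<phi> (p * q) = map_poly \<phi> p * map_poly \<phi> q"
proof -
  show 0: "\<phi> 0 = 0"
    using assms subringD(2)[OF assms(2)] ideal.subspace_0 by (auto simp: hom_on_def)
  show coeff: "coeff (map_poly \<phi> p) n = \<phi> (coeff p n)" for p n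
    by (simp add: coeff_map_poly 0)
  show "map_poly \<phi> (p + q) = map_poly \<phi> p + map_poly \<phi> q"
    if "p \<in> polys_over A" "q \<in> polys_over A"
    using assms(1) polys_overD[OF that(1)] polys_overD[OF that(2)]
    by (intro poly_eqI) (simp add: coeff hom_on_def)
  have sum: "\<phi> (sum f S) = (\<Sum>i\<in>S. \<phi> (f i))" if "\<And>i. f i \<in> A" for f and S :: "nat set"
    using assms(1) that subring_sum[OF assms(2), of _ f]
    by (induction S rule: infinite_finite_induct) (auto simp: 0 hom_on_def)
  show "map_poly \<phi> (p * q) = map_poly \<phi> p * map_poly \<phi> q"
    if "p \<in> polys_over A" "q \<in> polys_over A"
  proof (intro poly_eqI)
    fix n
    have "coeff (map_poly \<phi> (p * q)) n = (\<Sum>i\<le>n. \<phi> (coeff p i * coeff q (n - i)))"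
      unfolding coeff coeff_mult
      by (intro sum subringD(4)[OF assms(2)] polys_overD that)
    also have "\<dots> = coeff (map_poly \<phi> p * map_poly \<phi> q) n"
      using assms(1) polys_overD[OF that(1)] polys_overD[OF that(2)]
      by (simp add: coeff coeff_mult hom_on_def)
    finally show "coeff (map_poly \<phi> (p * q)) n = coeff (map_poly \<phi> p * map_poly \<phi> q) n" .
  qed
qed

lemma hom_on_minus:
  assumes "hom_on \<phi> A P" "subring A" "ideal.subspace P" "x \<in> A" "y \<in> A"
  shows "\<phi> (x - y) = \<phi> x - \<phi> y"
proof -
  have "\<phi> ((x - y) + y) = \<phi> (x - y) + \<phi> y"
    using assms(1,4,5) subringD(3)[OF assms(2,4,5)] unfolding hom_on_def by blast
  then show ?thesis by simp
qed

lemma hom_on_extend: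
  fixes \<phi> :: "'a::comm_ring_1 \<Rightarrow> 'k::field"
  assumes \<phi>: "hom_on \<phi> A P" and A: "subring A" and P: "ideal.subspace P"
    and \<xi>: "\<And>p. p \<in> polys_over A \<Longrightarrow> poly p z \<in> P \<Longrightarrow> poly (map_poly \<phi> p) \<xi> = 0"
  shows "\<exists>\<psi>. hom_on \<psi> (adjoin A z) P \<and> (\<forall>x\<in>A. \<psi> x = \<phi> x)
    \<and> (\<forall>p\<in>polys_over A. \<psi> (poly p z) = poly (map_poly \<phi> p) \<xi>)"
proof -
  note AT = subringD[OF subring_polys_over[OF A]]
  note hp = hom_on_poly[OF \<phi> A P]
  \<comment> \<open>The choice of \<open>p\<close> does not matter: two representations of
    \<open>x\<close> differ by a relation of \<open>z\<close>, whose image has \<xi> as a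
    root.\<close>
  define \<psi> where "\<psi> x = poly (map_poly \<phi> (SOME p. p \<in> polys_over A \<and> poly p z = x)) \<xi>" for x
  have \<psi>: "\<psi> (poly p z) = poly (map_poly \<phi> p) \<xi>" if p: "p \<in> polys_over A" for p
  proof -
    let ?q = "SOME q. q \<in> polys_over A \<and> poly q z = poly p z"
    have q: "?q \<in> polys_over A \<and> poly ?q z = poly p z"
      by (rule someI[of _ p]) (simp add: p)
    have "poly (map_poly \<phi> (?q - p)) \<xi> = 0"
      using q p AT ideal.subspace_0[OF P] by (intro \<xi>) auto
    moreover have "map_poly \<phi> ((?q - p) + p) = map_poly \<phi> (?q - p) + map_poly \<phi> p"
      using q p AT by (intro hp) auto
    ultimately show ?thesis by (simp add: \<psi>_def)
  qed
  have "\<psi> x = \<phi> x" if "x \<in> A" for x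
    using \<psi>[OF monom_polys_over[OF A that, of 0]] by (simp add: monom_0 map_poly_pCons hp)
  moreover have "hom_on \<psi> (adjoin A z) P"
    unfolding hom_on_def
  proof (intro conjI ballI)
    show "\<psi> 1 = 1"
      using \<psi>[OF AT(1)] \<phi> by (simp add: map_poly_1 hom_on_def)
    fix x assume "x \<in> adjoin A z"
    then obtain p where p: "p \<in> polys_over A" "x = poly p z" by (auto simp: adjoin_def)
    fix y assume "y \<in> adjoin A z"
    then obtain q where q: "q \<in> polys_over A" "y = poly q z" by (auto simp: adjoin_def)
    show "\<psi> (x + y) = \<psi> x + \<psi> y"
      using \<psi>[OF AT(6)[OF p(1) q(1)]] p q by (simp add: \<psi> hp)
    show "\<psi> (x * y) = \<psi> x * \<psi> y"
      using \<psi>[OF AT(4)[OF p(1) q(1)]] p q by (simp add: \<psi> hp)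
  next
    fix x assume "x \<in> adjoin A z \<inter> P"
    then show "\<psi> x = 0" using \<psi> \<xi> by (auto simp: adjoin_def)
  qed
  ultimately show ?thesis using \<psi> by blast
qed

text \<open>As in Euclid's proof: over a finite field, 1 plus the product of all
  \<open>[:- a, 1:]\<close> has positive degree and no root.\<close>

lemma infinite_UNIV_alg_closed: "infinite (UNIV :: 'k::alg_closed_field set)"
proof
  assume fin: "finite (UNIV :: 'k set)"
  let ?p = "(\<Prod>a\<in>(UNIV :: 'k set). [:- a, 1:]) + 1"
  have "degree (\<Prod>a\<in>(UNIV :: 'k set). [:- a, 1:]) = card (UNIV :: 'k set)"
    by (subst degree_prod_eq_sum_degree) auto
  moreover have "card (UNIV :: 'k set) > 0" using fin by (simp add: card_gt_0_iff)
  ultimately have "degree ?p > 0" by (subst degree_add_eq_left) auto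
  then obtain x where "poly ?p x = 0" using alg_closed_imp_poly_has_root by blast
  moreover have "poly (\<Prod>a\<in>(UNIV :: 'k set). [:- a, 1:]) x = 0"
    using fin by (auto simp: poly_prod prod_zero_iff)
  ultimately show False by simp
qed

lemma ex_nonroot:
  assumes "(p :: 'k::alg_closed_field poly) \<noteq> 0"
  obtains x where "poly p x \<noteq> 0"
  using poly_roots_finite[OF assms] infinite_UNIV_alg_closed by (metis (mono_tags) UNIV_I finite_subset mem_Collect_eq subsetI)

text \<open>Removes leading terms with coefficients in \<open>P\<close>, so that the degree becomes
  the degree modulo \<open>P\<close>.\<close>

lemma polys_mod_prime:
  assumes P: "ideal.subspace P" and A: "subring A"
    and p: "p \<in> polys_over A" "coeff p n \<notin> P"
  obtains q where "q \<in> polys_over A" "lead_coeff q \<notin> P" "degree q \<le> degree p" "poly p z - poly q z \<in> P"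
proof -
  note AT = subringD[OF subring_polys_over[OF A]]
  have "\<exists>q. q \<in> polys_over A \<and> lead_coeff q \<notin> P \<and> degree q \<le> degree p \<and> poly p z - poly q z \<in> P"
    using p
  proof (induction "degree p" arbitrary: p rule: less_induct)
    case less
    show ?case
    proof (cases "lead_coeff p \<in> P")
      case False
      then show ?thesis using less.prems ideal.subspace_0[OF P] by auto
    next
      case True
      let ?t = "monom (lead_coeff p) (degree p)"
      have deg: "n < degree p"
        using less.prems(2) True ideal.subspace_0[OF P] by (metis coeff_eq_0 linorder_neqE_nat)
      have c0: "coeff (p - ?t) k = 0" if "k \<ge> degree p" for k
        using that by (cases "k = degree p") (auto simp: coeff_eq_0)
      have "degree (p - ?t) < degree p"
      proof (rule degree_lessI)
        show "p - ?t \<noteq> 0 \<or> degree p > 0" using deg by simp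
      qed (use c0 in blast)
      moreover have "p - ?t \<in> polys_over A"
        by (intro AT less.prems monom_polys_over A polys_overD)
      moreover have "coeff (p - ?t) n \<notin> P"
        using less.prems deg by simp
      ultimately obtain q where q: "q \<in> polys_over A" "lead_coeff q \<notin> P" "degree q \<le> degree (p - ?t)"
        "poly (p - ?t) z - poly q z \<in> P"
        using less.hyps by blast
      have "(poly (p - ?t) z - poly q z) + z ^ degree p * lead_coeff p \<in> P"
        using q(4) True by (intro ideal.subspace_add[OF P] ideal.subspace_scale[OF P])
      then have "poly p z - poly q z \<in> P"
        by (simp add: poly_monom algebra_simps)
      then show ?thesis using q \<open>degree (p - ?t) < degree p\<close> by (meson less_le_trans nat_less_le order_trans)
    qed
  qed
  then show ?thesis using that by blast
qed

text \<open>
  \<open>u\<close> has an inverse modulo \<open>P\<close> up to a factor \<open>e \<in> A\<close>: a nonzero multiple of \<open>u\<close> of least degree in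
  \<open>z\<close> is constant, by Euclid's algorithm applied to it and the minimal polynomial \<open>m\<close> of \<open>z\<close>.
\<close>

lemma algebraic_multiple:
  assumes P: "prime_ideal P" and A: "subring A"
    and m: "m \<in> polys_over A" "lead_coeff m \<notin> P" "degree m > 0" "poly m z \<in> P"
    and min: "\<And>p n. p \<in> polys_over A \<Longrightarrow> degree p < degree m \<Longrightarrow> poly p z \<in> P \<Longrightarrow> coeff p n \<in> P"
    and u: "u \<in> adjoin A z" "u \<notin> P"
  obtains w e where "w \<in> adjoin A z" "e \<in> A" "e \<notin> P" "w * u - e \<in> P"
proof -
  have P': "ideal.subspace P" and prime: "\<And>x y. x * y \<in> P \<Longrightarrow> x \<in> P \<or> y \<in> P"
    using P by (auto simp: prime_ideal_def)
  note AT = subringD[OF subring_polys_over[OF A]] and Az = subringD[OF subring_adjoin[OF A]]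
  note Psub = ideal.subspace_diff[OF P'] and Pmul = ideal.subspace_scale[OF P'] and Padd = ideal.subspace_add[OF P']
  have poly_Az: "poly p z \<in> adjoin A z" if "p \<in> polys_over A" for p
    using that by (auto simp: adjoin_def)
  \<comment> \<open>The polynomials in \<open>z\<close> that represent nonzero multiples of
    \<open>u\<close> modulo \<open>P\<close>.\<close>
  let ?J = "\<lambda>r. r \<in> polys_over A \<and> poly r z \<notin> P \<and> (\<exists>w\<in>adjoin A z. w * u - poly r z \<in> P)"
  obtain p0 where p0: "p0 \<in> polys_over A" "u = poly p0 z"
    using u by (auto simp: adjoin_def)
  have "?J p0" using p0 u Az(1) ideal.subspace_0[OF P'] by (auto intro!: bexI[of _ 1])
  then obtain r where r: "?J r" and rmin: "\<And>q. ?J q \<Longrightarrow> degree r \<le> degree q"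
    using ex_has_least_nat[of ?J p0 degree] by blast
  then obtain w where w: "w \<in> adjoin A z" "w * u - poly r z \<in> P" by blast
  have deg: "degree r < degree m"
  proof -
    obtain s c q where q: "smult (lead_coeff m ^ s) r = m * c + q" "c \<in> polys_over A"
      "q \<in> polys_over A" "degree q < degree m"
      using pseudo_division[OF A m(1,3)] r by blast
    let ?b = "lead_coeff m ^ s"
    have eq: "?b * poly r z = poly m z * poly c z + poly q z"
      using arg_cong[OF q(1), of "\<lambda>p. poly p z"] by simp
    have "poly q z \<notin> P"
    proof
      assume "poly q z \<in> P"
      then have "?b * poly r z \<in> P" unfolding eq
        using Pmul[OF m(4), of "poly c z"] by (intro Padd) (auto simp: mult.commute)
      then show False using prime prime_ideal_power[OF P] m(2) r by blast
    qed
    moreover have "(?b * w) * u - poly q z \<in> P"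
    proof -
      have "?b * (w * u - poly r z) + poly c z * poly m z \<in> P"
        by (intro Padd Pmul w m)
      also have "?b * (w * u - poly r z) + poly c z * poly m z = (?b * w) * u - poly q z"
        using eq by (simp add: algebra_simps)
      finally show ?thesis .
    qed
    moreover have "?b * w \<in> adjoin A z"
      using adjoin_superset[OF A, of z] polys_overD[OF m(1)] by (intro Az w) auto
    ultimately have "?J q" using q(3) by blast
    then show ?thesis using rmin q(4) by fastforce
  qed
  \<comment> \<open>Otherwise divide \<open>m\<close> by \<open>r\<close>. The remainder represents
    a multiple of \<open>u\<close> of smaller degree, so it is zero modulo \<open>P\<close>; the
    quotient \<open>c\<close> then vanishes at \<open>z\<close>, and its degree is less than that of
    \<open>m\<close>, so its coefficients lie in \<open>P\<close>. This would put a power of the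
    leading coefficient of \<open>r\<close> times that of \<open>m\<close> into
    \<open>P\<close>.\<close>
  have "degree r = 0"
  proof (rule ccontr)
    assume "degree r \<noteq> 0"
    then have r0: "degree r > 0" by simp
    have lc: "lead_coeff r \<notin> P"
    proof
      assume *: "lead_coeff r \<in> P"
      let ?t = "monom (lead_coeff r) (degree r)"
      have c0: "coeff (r - ?t) k = 0" if "k \<ge> degree r" for k
        using that by (cases "k = degree r") (auto simp: coeff_eq_0)
      have "degree (r - ?t) < degree r"
      proof (rule degree_lessI)
        show "r - ?t \<noteq> 0 \<or> degree r > 0" using r0 ..
      qed (use c0 in blast)
      moreover have "r - ?t \<in> polys_over A"
        using r by (intro AT monom_polys_over A polys_overD) auto
      moreover have t: "poly ?t z \<in> P"
        using Pmul[OF *, of "z ^ degree r"] by (simp add: poly_monom mult.commute)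
      moreover have "poly (r - ?t) z \<notin> P"
      proof
        assume "poly (r - ?t) z \<in> P"
        from Padd[OF this t] have "poly r z \<in> P" by simp
        then show False using r by blast
      qed
      moreover have "w * u - poly (r - ?t) z \<in> P"
        using Padd[OF w(2) t] by (simp add: algebra_simps)
      ultimately show False using rmin[of "r - ?t"] w(1) by force
    qed
    obtain s c q where q: "smult (lead_coeff r ^ s) m = r * c + q" "c \<in> polys_over A"
      "q \<in> polys_over A" "degree q < degree r" "degree c \<le> degree m - degree r"
      using pseudo_division[OF A, of r m] r r0 m(1) by blast
    let ?b = "lead_coeff r ^ s"
    have eq: "?b * poly m z = poly r z * poly c z + poly q z"
      using arg_cong[OF q(1), of "\<lambda>p. poly p z"] by simp
    have "poly q z \<in> P"
    proof (rule ccontr)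
      assume "poly q z \<notin> P"
      moreover have "(- poly c z * w) * u - poly q z \<in> P"
      proof -
        have "(- poly c z) * (w * u - poly r z) - ?b * poly m z \<in> P"
          by (intro Psub Pmul w m)
        also have "(- poly c z) * (w * u - poly r z) - ?b * poly m z = (- poly c z * w) * u - poly q z"
          unfolding eq by (simp add: algebra_simps)
        finally show ?thesis .
      qed
      moreover have "- poly c z * w \<in> adjoin A z"
        by (intro Az w poly_Az q)
      ultimately have "?J q" using q(3) by blast
      then show False using rmin q(4) by fastforce
    qed
    then have qc: "coeff q n \<in> P" for n
      using min[OF q(3)] q(4) deg by auto
    have "poly r z * poly c z = ?b * poly m z - poly q z" by (simp add: eq)
    also have "\<dots> \<in> P" by (intro Psub Pmul m \<open>poly q z \<in> P\<close>)
    finally have "poly c z \<in> P" using prime r by blast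
    then have cc: "coeff c n \<in> P" for n
      using min[OF q(2)] q(5) r0 deg by auto
    have "coeff (r * c) n \<in> P" for n
      unfolding coeff_mult by (intro ideal.subspace_sum[OF P'] Pmul cc)
    then have "coeff (r * c + q) (degree m) \<in> P" using qc by (auto intro: Padd)
    then have "?b * lead_coeff m \<in> P" by (simp flip: q(1))
    then show False using prime prime_ideal_power[OF P] lc m(2) by blast
  qed
  then obtain e where e: "r = [:e:]" by (meson degree_eq_zeroE)
  show ?thesis
  proof (rule that[of w e])
    show "e \<in> A" using polys_overD[of r A 0] r by (simp add: e)
    show "e \<notin> P" "w * u - e \<in> P" using r w by (simp_all add: e)
  qed (rule w)
qed

text \<open>The quantifiers matter: \<open>u'\<close> is found before \<phi>. Thus the condition on
  \<open>u\<close> can be pushed down through a chain of adjunctions to the base ring before any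
  homomorphism is built.\<close>

lemma hom_on_extend_nonzero:
  assumes P: "prime_ideal P" and A: "subring A" and u: "u \<in> adjoin A z" "u \<notin> P"
  shows "\<exists>u'\<in>A - P. \<forall>\<phi> :: 'a::comm_ring_1 \<Rightarrow> 'k::alg_closed_field. hom_on \<phi> A P \<and> \<phi> u' \<noteq> 0 \<longrightarrow>
    (\<exists>\<psi>. hom_on \<psi> (adjoin A z) P \<and> (\<forall>x\<in>A. \<psi> x = \<phi> x) \<and> \<psi> u \<noteq> 0)"
proof -
  have P': "ideal.subspace P" and prime: "\<And>x y. x * y \<in> P \<Longrightarrow> x \<in> P \<or> y \<in> P"
    using P by (auto simp: prime_ideal_def)
  note AT = subringD[OF subring_polys_over[OF A]] and Az = subringD[OF subring_adjoin[OF A]]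
  obtain p0 where p0: "p0 \<in> polys_over A" "u = poly p0 z"
    using u by (auto simp: adjoin_def)
  have zeros: "poly p z \<in> P" if "\<And>n. coeff p n \<in> P" for p
    unfolding poly_altdef
    by (intro ideal.subspace_sum[OF P']) (subst mult.commute, intro ideal.subspace_scale[OF P' that])
  let ?rel = "\<lambda>p. p \<in> polys_over A \<and> poly p z \<in> P \<and> (\<exists>n. coeff p n \<notin> P)"
  show ?thesis
  proof (cases "\<exists>p. ?rel p")
    \<comment> \<open>\<open>z\<close> is transcendental modulo \<open>P\<close>: every \<xi> is
      admissible, and it only has to avoid the roots of the image of \<open>p0\<close>.\<close>
    case False
    obtain n where n: "coeff p0 n \<notin> P" using zeros u(2) p0(2) by blast
    show ?thesis
    proof (intro bexI[of _ "coeff p0 n"] allI impI)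
      show "coeff p0 n \<in> A - P" using n polys_overD[OF p0(1)] by blast
      fix \<phi> :: "'a \<Rightarrow> 'k" assume \<phi>: "hom_on \<phi> A P \<and> \<phi> (coeff p0 n) \<noteq> 0"
      then have h: "hom_on \<phi> A P" by blast
      note hp = hom_on_poly[OF h A P']
      have "map_poly \<phi> p0 \<noteq> 0" using \<phi> hp(2)[of p0 n] by auto
      then obtain \<xi> where \<xi>: "poly (map_poly \<phi> p0) \<xi> \<noteq> 0" by (rule ex_nonroot)
      have zero: "poly (map_poly \<phi> p) \<xi> = 0" if "p \<in> polys_over A" "poly p z \<in> P" for p
      proof -
        have "coeff (map_poly \<phi> p) k = 0" for k
          unfolding hp(2) using False that h polys_overD[OF that(1), of k] by (auto simp: hom_on_def)
        then show ?thesis by (simp add: poly_eq_iff[symmetric] poly_altdef)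
      qed
      have "\<exists>\<psi>. hom_on \<psi> (adjoin A z) P \<and> (\<forall>x\<in>A. \<psi> x = \<phi> x)
          \<and> (\<forall>p\<in>polys_over A. \<psi> (poly p z) = poly (map_poly \<phi> p) \<xi>)"
        by (rule hom_on_extend[OF h A P']) (rule zero)
      then show "\<exists>\<psi>. hom_on \<psi> (adjoin A z) P \<and> (\<forall>x\<in>A. \<psi> x = \<phi> x) \<and> \<psi> u \<noteq> 0"
        using p0 \<xi> by auto
    qed
  next
    case True
    then obtain m0 where m0: "?rel m0" and min0: "\<And>p. ?rel p \<Longrightarrow> degree m0 \<le> degree p"
      using ex_has_least_nat[of ?rel _ degree] by blast
    then obtain n0 where "coeff m0 n0 \<notin> P" by blast
    then obtain m where m: "m \<in> polys_over A" "lead_coeff m \<notin> P" "degree m \<le> degree m0"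
      "poly m0 z - poly m z \<in> P"
      using polys_mod_prime[OF P' A] m0 by blast
    have mz: "poly m z \<in> P"
      using ideal.subspace_diff[OF P' _ m(4), of "poly m0 z"] m0 by simp
    have min: "coeff p n \<in> P" if "p \<in> polys_over A" "degree p < degree m" "poly p z \<in> P" for p n
      using min0[of p] that m(3) by auto
    have deg: "degree m > 0"
    proof (rule ccontr)
      assume "\<not> degree m > 0"
      then obtain e where "m = [:e:]" by (meson degree_eq_zeroE not_gr_zero)
      then show False using mz m(2) by simp
    qed
    obtain w e where we: "w \<in> adjoin A z" "e \<in> A" "e \<notin> P" "w * u - e \<in> P"
      using algebraic_multiple[OF P A m(1,2) deg mz min u] by blast
    let ?a = "lead_coeff m"
    have a: "?a \<in> A" using polys_overD[OF m(1)] .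
    \<comment> \<open>If \<phi> does not kill \<open>?a\<close>, the image of \<open>m\<close> keeps
      a positive degree and has a root; if it does not kill \<open>e\<close>, then
      \<open>w * u = e\<close> modulo \<open>P\<close> forces \<psi> \<open>u\<close> to be
      nonzero.\<close>
    show ?thesis
    proof (intro bexI[of _ "?a * e"] allI impI)
      show "?a * e \<in> A - P" using a we m(2) prime subringD(4)[OF A] by blast
      fix \<phi> :: "'a \<Rightarrow> 'k" assume \<phi>: "hom_on \<phi> A P \<and> \<phi> (?a * e) \<noteq> 0"
      then have h: "hom_on \<phi> A P" by blast
      have ae: "\<phi> ?a \<noteq> 0" "\<phi> e \<noteq> 0" using \<phi> a we by (auto simp: hom_on_def)
      note hp = hom_on_poly[OF h A P']
      have "degree (map_poly \<phi> m) \<ge> degree m" using ae hp(2) by (intro le_degree) auto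
      then obtain \<xi> where \<xi>: "poly (map_poly \<phi> m) \<xi> = 0"
        using alg_closed_imp_poly_has_root deg by (metis less_le_trans)
      \<comment> \<open>Up to a power of \<open>?a\<close>, the minimal polynomial \<open>m\<close>
        divides every relation of \<open>z\<close> modulo \<open>P\<close>: the remainder is a
        relation of smaller degree.\<close>
      have zero: "poly (map_poly \<phi> p) \<xi> = 0" if p: "p \<in> polys_over A" "poly p z \<in> P" for p
      proof -
        obtain s c r where r: "smult (?a ^ s) p = m * c + r" "c \<in> polys_over A"
          "r \<in> polys_over A" "degree r < degree m"
          using pseudo_division[OF A m(1) deg p(1)] by blast
        have "poly r z = ?a ^ s * poly p z - poly c z * poly m z"
          using arg_cong[OF r(1), of "\<lambda>p. poly p z"] by (simp add: mult.commute)
        also have "\<dots> \<in> P"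
          by (intro ideal.subspace_diff[OF P'] ideal.subspace_scale[OF P'] p mz)
        finally have "coeff r k \<in> P" for k using min r by blast
        then have "coeff (map_poly \<phi> r) k = 0" for k
          unfolding hp(2) using h polys_overD[OF r(3), of k] by (auto simp: hom_on_def)
        then have "map_poly \<phi> r = 0" by (simp add: poly_eq_iff)
        moreover have "map_poly \<phi> (monom (?a ^ s) 0 * p) = map_poly \<phi> (monom (?a ^ s) 0) * map_poly \<phi> p"
          by (intro hp p monom_polys_over A subringD(7)[OF A] a)
        moreover have "map_poly \<phi> (m * c + r) = map_poly \<phi> m * map_poly \<phi> c + map_poly \<phi> r"
          using hp(3)[OF AT(4)[OF m(1) r(2)] r(3)] hp(4)[OF m(1) r(2)] by simp
        ultimately have "map_poly \<phi> (monom (?a ^ s) 0) * map_poly \<phi> p = map_poly \<phi> m * map_poly \<phi> c"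
          using r(1) by (simp add: monom_0)
        then have "\<phi> (?a ^ s) * poly (map_poly \<phi> p) \<xi> = poly (map_poly \<phi> m) \<xi> * poly (map_poly \<phi> c) \<xi>"
          by (metis (no_types) monom_0 map_poly_pCons map_poly_0 hp(1) poly_mult poly_pCons mult_zero_right poly_0 add.right_neutral)
        moreover have "\<phi> (?a ^ k) = \<phi> ?a ^ k" for k
        proof (induction k)
          case (Suc k)
          have "\<phi> (?a * ?a ^ k) = \<phi> ?a * \<phi> (?a ^ k)"
            using h a subringD(7)[OF A a] unfolding hom_on_def by blast
          then show ?case by (simp add: Suc)
        qed (use h in \<open>simp add: hom_on_def\<close>)
        ultimately show ?thesis using \<xi> ae by auto
      qed
      have "\<exists>\<psi>. hom_on \<psi> (adjoin A z) P \<and> (\<forall>x\<in>A. \<psi> x = \<phi> x)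
          \<and> (\<forall>p\<in>polys_over A. \<psi> (poly p z) = poly (map_poly \<phi> p) \<xi>)"
        by (rule hom_on_extend[OF h A P']) (rule zero)
      then obtain \<psi> where \<psi>: "hom_on \<psi> (adjoin A z) P" "\<And>x. x \<in> A \<Longrightarrow> \<psi> x = \<phi> x" by blast
      have e: "e \<in> adjoin A z" using adjoin_superset[OF A] we by blast
      have wu: "w * u \<in> adjoin A z" using we u by (intro Az)
      have "\<psi> (w * u - e) = 0"
        using \<psi>(1) we(4) Az(3)[OF wu e] by (simp add: hom_on_def)
      then have "\<psi> w * \<psi> u = \<phi> e"
        using hom_on_minus[OF \<psi>(1) subring_adjoin[OF A] P' wu e] \<psi> we u by (simp add: hom_on_def)
      then have "\<psi> u \<noteq> 0" using ae by auto
      then show "\<exists>\<psi>. hom_on \<psi> (adjoin A z) P \<and> (\<forall>x\<in>A. \<psi> x = \<phi> x) \<and> \<psi> u \<noteq> 0"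
        using \<psi> by blast
    qed
  qed
qed

lemma hom_on_extend_list:
  fixes \<phi> :: "'a::comm_ring_1 \<Rightarrow> 'k::alg_closed_field"
  assumes P: "prime_ideal P" and A: "subring A" and u: "u \<in> foldr (\<lambda>z B. adjoin B z) zs A" "u \<notin> P"
    and nz: "\<And>x. x \<in> A - P \<Longrightarrow> \<phi> x \<noteq> 0" and \<phi>: "hom_on \<phi> A P"
  shows "\<exists>\<psi>. hom_on \<psi> (foldr (\<lambda>z B. adjoin B z) zs A) P \<and> (\<forall>x\<in>A. \<psi> x = \<phi> x) \<and> \<psi> u \<noteq> 0"
proof -
  let ?B = "\<lambda>zs. foldr (\<lambda>z B. adjoin B z) zs A"
  have B: "subring (?B zs) \<and> A \<subseteq> ?B zs" for zs
  proof (induction zs)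
    case (Cons z zs)
    then show ?case
      using subring_adjoin[of "?B zs" z] adjoin_superset[of "?B zs" z] by auto
  qed (simp add: A)
  show ?thesis
    using u
  proof (induction zs arbitrary: u)
    case Nil
    then show ?case using nz \<phi> by auto
  next
    case (Cons z zs)
    from hom_on_extend_nonzero[OF P conjunct1[OF B[of zs]], of u z, where 'k = 'k] Cons.prems
    obtain u' where u': "u' \<in> ?B zs - P"
      and ext: "\<And>\<phi> :: 'a \<Rightarrow> 'k. hom_on \<phi> (?B zs) P \<Longrightarrow> \<phi> u' \<noteq> 0 \<Longrightarrow>
        \<exists>\<psi>. hom_on \<psi> (adjoin (?B zs) z) P \<and> (\<forall>x\<in>?B zs. \<psi> x = \<phi> x) \<and> \<psi> u \<noteq> 0"
      by auto
    from Cons.IH[of u'] u' obtain \<psi> where \<psi>: "hom_on \<psi> (?B zs) P" "\<forall>x\<in>A. \<psi> x = \<phi> x" "\<psi> u' \<noteq> 0"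
      by auto
    from ext[OF \<psi>(1,3)] obtain \<psi>' where
      "hom_on \<psi>' (adjoin (?B zs) z) P" "\<forall>x\<in>?B zs. \<psi>' x = \<psi> x" "\<psi>' u \<noteq> 0" by blast
    then show ?case using \<psi>(2) B[of zs] by (intro exI[of _ \<psi>']) auto
  qed
qed

text \<open>If no power of \<open>u\<close> is in the ideal, some prime contains the ideal but not
  \<open>u\<close>. Adjoining the variables to the constants one by one gives a
  \<open>k\<close>-homomorphism that kills the prime but not \<open>u\<close>; it is evaluation at
  the point formed by the images of the variables.\<close>

theorem nullstellensatz:
  fixes u :: "('k::alg_closed_field, 'n::finite) mpoly"
  assumes "\<And>v. (\<And>p. p \<in> S \<Longrightarrow> peval p v = 0) \<Longrightarrow> peval u v = 0"
  shows "\<exists>n. u ^ n \<in> ideal.span S"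
proof (rule ccontr)
  assume "\<not> (\<exists>n. u ^ n \<in> ideal.span S)"
  then obtain P where P: "prime_ideal P" "ideal.span S \<subseteq> P" "u \<notin> P"
    using prime_ideal_avoiding_powers[OF ideal.subspace_span] by metis
  let ?A = "range Const :: ('k, 'n) mpoly set"
  let ?\<phi> = "\<lambda>p :: ('k, 'n) mpoly. peval p 0"
  obtain xs :: "'n list" where xs: "set xs = UNIV" using finite_list[OF finite] by blast
  let ?B = "\<lambda>xs. foldr (\<lambda>z B. adjoin B z) (map X xs) ?A"
  have A: "subring ?A"
    unfolding subring_def by (auto simp flip: Const.hom_diff Const.hom_mult intro: range_eqI[of _ _ 1])
  have units: "c = 0" if "Const c \<in> P" for c :: 'k
  proof (rule ccontr)
    assume "c \<noteq> 0"
    then have "Const (inverse c) * Const c = (1 :: ('k, 'n) mpoly)" by (simp flip: Const.hom_mult)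
    then show False
      using P(1) that ideal.subspace_scale[of P "Const c" "Const (inverse c)"] by (auto simp: prime_ideal_def)
  qed
  have B: "subring (?B ys) \<and> ?A \<subseteq> ?B ys \<and> X ` set ys \<subseteq> ?B ys" for ys
  proof (induction ys)
    case (Cons z zs)
    then show ?case
      using subring_adjoin[of "?B zs" "X z"] adjoin_superset[of "?B zs" "X z"] adjoin_mem[of "?B zs" "X z"] by auto
  qed (simp add: A)
  have "p \<in> ?B xs" for p
  proof -
    have "p = poly_subst Const X p" by (simp add: poly_subst_Const_X)
    also have "\<dots> \<in> ?B xs"
      unfolding poly_subst_def using B[of xs] xs
      by (intro subring_sum subring_prod subringD(4,7)) auto
    finally show ?thesis .
  qed
  then have UNIV: "?B xs = UNIV" by auto
  have "hom_on ?\<phi> ?A P" by (auto simp: hom_on_def dest: units)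
  moreover have "?\<phi> x \<noteq> 0" if "x \<in> ?A - P" for x
    using that P(1) ideal.subspace_0[of P] by (auto simp: prime_ideal_def)
  moreover have "u \<in> ?B xs" using UNIV by simp
  ultimately obtain \<psi> :: "('k, 'n) mpoly \<Rightarrow> 'k"
    where \<psi>: "hom_on \<psi> (?B xs) P" "\<And>c. \<psi> (Const c) = c" "\<psi> u \<noteq> 0"
    using hom_on_extend_list[OF P(1) A, of u "map X xs" ?\<phi>] P(3) by auto
  have hom: "cring_hom \<psi>"
    using \<psi>(1) unfolding UNIV hom_on_def by unfold_locales auto
  let ?v = "\<chi> i. \<psi> (X i)"
  have eval: "\<psi> p = peval p ?v" for p
    by (rule hom_mpoly_eq[OF hom peval.cring_hom_axioms]) (simp_all add: \<psi>(2))
  have "peval p ?v = 0" if "p \<in> S" for p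
  proof -
    have "p \<in> P" using P(2) ideal.span_base[OF that] by blast
    then have "\<psi> p = 0" using \<psi>(1) unfolding UNIV hom_on_def by blast
    then show ?thesis by (simp only: eval[symmetric])
  qed
  then have "peval u ?v = 0" by (rule assms)
  then have "\<psi> u = 0" by (simp only: eval[symmetric])
  then show False using \<psi>(3) by contradiction
qed

section \<open>Koszul complexes in characteristic 2\<close>

text \<open>
  Chains are functions on subsets of the index set \<open>J\<close>; the subsets of cardinality \<open>i\<close> carry the part
  of degree \<open>i\<close>. In characteristic 2 the usual signs disappear.
\<close>

definition koszul_diff :: "'j set \<Rightarrow> ('j \<Rightarrow> 'a::comm_ring_1) \<Rightarrow> ('j set \<Rightarrow> 'a) \<Rightarrow> 'j set \<Rightarrow> 'a" where
  "koszul_diff J f c S = (\<Sum>j\<in>J - S. f j * c (insert j S))"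

text \<open>Exterior multiplication by the element of degree 1 with coefficients
  \<open>\<mu> j\<close>, without signs.\<close>

definition koszul_wedge :: "('j \<Rightarrow> 'a::comm_ring_1) \<Rightarrow> ('j set \<Rightarrow> 'a) \<Rightarrow> 'j set \<Rightarrow> 'a" where
  "koszul_wedge \<mu> c S = (\<Sum>j\<in>S. \<mu> j * c (S - {j}))"

lemma koszul_diff_linear:
  "koszul_diff J f (\<lambda>S. a * u S - v S - b * w S) S
     = a * koszul_diff J f u S - koszul_diff J f v S - b * koszul_diff J f w S"
  unfolding koszul_diff_def
  by (simp only: right_diff_distrib sum_subtractf sum_distrib_left mult.left_commute)

lemma koszul_diff_mem:
  assumes "ideal.subspace I" "\<And>j. j \<in> J - S \<Longrightarrow> c (insert j S) \<in> I"
  shows "koszul_diff J f c S \<in> I"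
  unfolding koszul_diff_def
  by (rule ideal.subspace_sum[OF assms(1)]) (rule ideal.subspace_scale[OF assms])

lemma sum_symmetric_char_2:
  fixes g :: "'j \<Rightarrow> 'j \<Rightarrow> 'a::comm_ring_1"
  assumes "finite T" and char: "\<And>x :: 'a. x + x = 0" and "\<And>j k. g j k = g k j"
  shows "(\<Sum>j\<in>T. \<Sum>k\<in>T - {j}. g j k) = 0"
  using assms(1)
proof induction
  case (insert t T)
  have "(\<Sum>k\<in>insert t T - {j}. g j k) = g j t + (\<Sum>k\<in>T - {j}. g j k)" if "j \<in> T" for j
  proof -
    have "insert t T - {j} = insert t (T - {j})" using insert that by auto
    then show ?thesis using insert by simp
  qed
  moreover have "insert t T - {t} = T" using insert by auto
  ultimately have "(\<Sum>j\<in>insert t T. \<Sum>k\<in>insert t T - {j}. g j k)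
      = (\<Sum>k\<in>T. g t k) + ((\<Sum>j\<in>T. g j t) + (\<Sum>j\<in>T. \<Sum>k\<in>T - {j}. g j k))"
    using insert by (simp add: sum.distrib)
  also have "\<dots> = (\<Sum>k\<in>T. g t k) + (\<Sum>k\<in>T. g t k)"
    using insert by (simp add: assms(3)[of _ t])
  finally show ?case by (simp add: char)
qed simp

lemma koszul_diff_diff:
  fixes f :: "'j \<Rightarrow> 'a::comm_ring_1"
  assumes "finite J" and char: "\<And>x :: 'a. x + x = 0"
  shows "koszul_diff J f (koszul_diff J f c) S = 0"
proof -
  have "koszul_diff J f (koszul_diff J f c) S
      = (\<Sum>j\<in>J - S. \<Sum>k\<in>J - S - {j}. f j * f k * c (insert j (insert k S)))"
    unfolding koszul_diff_def
    by (intro sum.cong refl)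
      (simp add: sum_distrib_left mult.assoc insert_commute Diff_insert2[symmetric] Diff_insert[symmetric])
  also have "\<dots> = 0"
    by (rule sum_symmetric_char_2) (use assms in \<open>auto simp: insert_commute mult_ac\<close>)
  finally show ?thesis .
qed

text \<open>The Leibniz rule, which makes the wedge a homotopy from 0 to multiplication by the sum
  of the \<open>f j * \<mu> j\<close>. The mixed terms \<open>?C\<close> occur on both sides, and
  the sum over \<open>S\<close> occurs twice on the right, so it cancels.\<close>

lemma koszul_diff_wedge:
  fixes f :: "'j \<Rightarrow> 'a::comm_ring_1"
  assumes J: "finite J" and char: "\<And>x :: 'a. x + x = 0" and S: "S \<subseteq> J"
  shows "koszul_diff J f (koszul_wedge \<mu> c) S = (\<Sum>j\<in>J. f j * \<mu> j) * c S + koszul_wedge \<mu> (koszul_diff J f c) S"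
proof -
  let ?C = "\<Sum>j\<in>J - S. \<Sum>k\<in>S. f j * \<mu> k * c (insert j (S - {k}))"
  have fin: "finite S" using J S finite_subset by blast
  have "koszul_diff J f (koszul_wedge \<mu> c) S
      = (\<Sum>j\<in>J - S. f j * \<mu> j * c S + (\<Sum>k\<in>S. f j * \<mu> k * c (insert j (S - {k}))))"
    unfolding koszul_diff_def
  proof (intro sum.cong refl)
    fix j assume j: "j \<in> J - S"
    then have "insert j S - {k} = insert j (S - {k})" if "k \<in> S" for k using that by auto
    moreover have "insert j S - {j} = S" using j by auto
    ultimately have "koszul_wedge \<mu> c (insert j S) = \<mu> j * c S + (\<Sum>k\<in>S. \<mu> k * c (insert j (S - {k})))"
      using j fin unfolding koszul_wedge_def by simp
    then show "f j * koszul_wedge \<mu> c (insert j S) = f j * \<mu> j * c S + (\<Sum>k\<in>S. f j * \<mu> k * c (insert j (S - {k})))"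
      by (simp add: distrib_left sum_distrib_left mult.assoc)
  qed
  then have 1: "koszul_diff J f (koszul_wedge \<mu> c) S = (\<Sum>j\<in>J - S. f j * \<mu> j) * c S + ?C"
    by (simp add: sum.distrib sum_distrib_right)
  have "koszul_wedge \<mu> (koszul_diff J f c) S
      = (\<Sum>k\<in>S. f k * \<mu> k * c S + (\<Sum>j\<in>J - S. f j * \<mu> k * c (insert j (S - {k}))))"
    unfolding koszul_wedge_def
  proof (intro sum.cong refl)
    fix k assume k: "k \<in> S"
    then have "J - (S - {k}) = insert k (J - S)" "insert k (S - {k}) = S" using S by auto
    then have "koszul_diff J f c (S - {k}) = f k * c S + (\<Sum>j\<in>J - S. f j * c (insert j (S - {k})))"
      using k J unfolding koszul_diff_def by simp
    then show "\<mu> k * koszul_diff J f c (S - {k}) = f k * \<mu> k * c S + (\<Sum>j\<in>J - S. f j * \<mu> k * c (insert j (S - {k})))"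
      by (simp add: distrib_left sum_distrib_left mult_ac)
  qed
  then have 2: "koszul_wedge \<mu> (koszul_diff J f c) S = (\<Sum>k\<in>S. f k * \<mu> k) * c S + ?C"
    by (simp add: sum.distrib sum_distrib_right sum.swap[of _ S])
  have "(\<Sum>j\<in>J. f j * \<mu> j) = (\<Sum>j\<in>J - S. f j * \<mu> j) + (\<Sum>j\<in>S. f j * \<mu> j)"
    using J S by (simp add: sum.subset_diff)
  moreover have "A * C + D = (A + B) * C + (B * C + D)" for A B C D :: 'a
  proof -
    have "(A + B) * C + (B * C + D) = A * C + D + (B * C + B * C)" by (simp add: algebra_simps)
    then show ?thesis by (simp only: char) simp
  qed
  ultimately show ?thesis unfolding 1 2 by simp
qed

text \<open>
  Depth sensitivity of the Koszul complex: after localising at \<open>q\<close> the ideal of the \<open>f j\<close> contains the regular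
  sequence \<open>x 0, \<dots>, x (n - 1)\<close>, which is no shorter than the family \<open>f\<close>, so \<open>f\<close> has no
  first Koszul homology. The induction shows, for descending \<open>k\<close>, that the homology of degree \<open>k + 1\<close> modulo
  \<open>x 0, \<dots>, x (k - 1)\<close> vanishes: \<open>q * x k\<close> annihilates homology, by the homotopy \<open>koszul_wedge (\<mu> k)\<close>.
\<close>

lemma koszul_syzygy:
  fixes f :: "'j \<Rightarrow> 'a::comm_ring_1"
  assumes J: "finite J" "card J \<le> n" and char: "\<And>x :: 'a. x + x = 0"
    and I: "\<And>k. ideal.subspace (I k)" "I 0 = {0}"
    and I_Suc: "\<And>k z. k < n \<Longrightarrow> z \<in> I (Suc k) \<longleftrightarrow> (\<exists>y. z - x k * y \<in> I k)"
    and reg: "\<And>k y. k < n \<Longrightarrow> x k * y \<in> I k \<Longrightarrow> y \<in> I k"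
    and \<mu>: "\<And>k. k < n \<Longrightarrow> q * x k = (\<Sum>j\<in>J. f j * \<mu> k j)"
    and c: "(\<Sum>j\<in>J. f j * c j) = 0"
  shows "\<exists>m. \<forall>j\<in>J. q ^ m * c j \<in> ideal.span (f ` (J - {j}))"
proof -
  let ?d = "koszul_diff J f"
  note Isub = ideal.subspace_diff[OF I(1)] and Imul = ideal.subspace_scale[OF I(1)] and Isum = ideal.subspace_sum[OF I(1)]
  \<comment> \<open>Cycles of degree \<open>k + 1\<close> modulo \<open>I k\<close> become
    boundaries after multiplication by a power of \<open>q\<close>.\<close>
  define Q where "Q k \<longleftrightarrow> (\<forall>c. (\<forall>S\<subseteq>J. card S = k \<longrightarrow> ?d c S \<in> I k) \<longrightarrow>
      (\<exists>b m. \<forall>S\<subseteq>J. card S = Suc k \<longrightarrow> q ^ m * c S - ?d b S \<in> I k))" for k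
  have step: "Q k" if Qk: "Q (Suc k)" and k: "k < n" for k
    unfolding Q_def
  proof (intro allI impI)
    fix c assume c: "\<forall>S\<subseteq>J. card S = k \<longrightarrow> ?d c S \<in> I k"
    let ?w = "koszul_wedge (\<mu> k) c"
    have dw: "?d ?w S - q * x k * c S \<in> I k" if S: "S \<subseteq> J" "card S = Suc k" for S
    proof -
      have "koszul_wedge (\<mu> k) (?d c) S \<in> I k"
        unfolding koszul_wedge_def
      proof (intro Isum Imul)
        fix j assume "j \<in> S"
        then have "card (S - {j}) = k" using S by simp
        then show "?d c (S - {j}) \<in> I k" using c S by blast
      qed
      then show ?thesis
        using koszul_diff_wedge[OF J(1) char S(1), of f "\<mu> k" c] \<mu>[OF k] by simp
    qed
    \<comment> \<open>Since \<open>?d ?w\<close> equals \<open>q * x k * c\<close> modulo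
      \<open>I k\<close>, the wedge is a cycle modulo \<open>I (Suc k)\<close>, and
      \<open>Q (Suc k)\<close> writes \<open>q ^ m * ?w\<close> as a boundary plus
      \<open>x k * y\<close>. Applying \<open>?d\<close> once more kills the boundary; regularity
      then cancels \<open>x k\<close> and leaves \<open>q ^ Suc m * c = ?d y\<close>.\<close>
    have "?d ?w S \<in> I (Suc k)" if S: "S \<subseteq> J" "card S = Suc k" for S
      unfolding I_Suc[OF k] using dw[OF S] by (intro exI[of _ "q * c S"]) (simp add: mult_ac)
    then obtain b m where b: "\<And>S. S \<subseteq> J \<Longrightarrow> card S = Suc (Suc k) \<Longrightarrow> q ^ m * ?w S - ?d b S \<in> I (Suc k)"
      using Qk unfolding Q_def by blast
    have "\<forall>S. \<exists>y. S \<subseteq> J \<and> card S = Suc (Suc k) \<longrightarrow> q ^ m * ?w S - ?d b S - x k * y \<in> I k"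
      using b I_Suc[OF k] by blast
    then obtain y where y: "\<And>S. S \<subseteq> J \<Longrightarrow> card S = Suc (Suc k) \<Longrightarrow> q ^ m * ?w S - ?d b S - x k * y S \<in> I k"
      by metis
    have "q ^ Suc m * c S - ?d y S \<in> I k" if S: "S \<subseteq> J" "card S = Suc k" for S
    proof -
      have "?d (\<lambda>S. q ^ m * ?w S - ?d b S - x k * y S) S \<in> I k"
      proof (intro koszul_diff_mem I(1) y)
        fix j assume j: "j \<in> J - S"
        show "insert j S \<subseteq> J" using j S by blast
        show "card (insert j S) = Suc (Suc k)"
          using j S finite_subset[OF S(1) J(1)] by simp
      qed
      also have "?d (\<lambda>S. q ^ m * ?w S - ?d b S - x k * y S) S = q ^ m * ?d ?w S - ?d (?d b) S - x k * ?d y S"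
        by (rule koszul_diff_linear)
      finally have "q ^ m * ?d ?w S - x k * ?d y S \<in> I k"
        by (simp add: koszul_diff_diff[OF J(1) char])
      from Isub[OF this Imul[OF dw[OF S], of "q ^ m"]]
      have "x k * (q ^ Suc m * c S - ?d y S) \<in> I k" by (simp add: algebra_simps)
      then show ?thesis by (rule reg[OF k])
    qed
    then show "\<exists>b m. \<forall>S\<subseteq>J. card S = Suc k \<longrightarrow> q ^ m * c S - ?d b S \<in> I k" by blast
  qed
  \<comment> \<open>The descent starts at \<open>k = n\<close>, where there are no chains of degree
    \<open>n + 1\<close>; this is where \<open>card J \<le> n\<close> enters.\<close>
  have "card S \<noteq> Suc n" if "S \<subseteq> J" for S
    using card_mono[OF J(1) that] J(2) by simp
  then have "Q n" unfolding Q_def by blast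
  have "Q 0"
    by (rule inc_induct[of 0 n Q]) (use \<open>Q n\<close> step in auto)
  moreover have "?d (\<lambda>S. c (the_elem S)) {} = 0"
    using c by (simp add: koszul_diff_def)
  moreover have "S = {}" if "S \<subseteq> J" "card S = 0" for S
    using that finite_subset[OF _ J(1)] by auto
  ultimately have "\<exists>b m. \<forall>S\<subseteq>J. card S = Suc 0 \<longrightarrow> q ^ m * c (the_elem S) - ?d b S \<in> I 0"
    unfolding Q_def I(2) by blast
  then obtain b m where b: "\<And>S. S \<subseteq> J \<Longrightarrow> card S = 1 \<Longrightarrow> q ^ m * c (the_elem S) - ?d b S = 0"
    unfolding I(2) by auto
  have "q ^ m * c j \<in> ideal.span (f ` (J - {j}))" if j: "j \<in> J" for j
  proof -
    have "q ^ m * c j = ?d b {j}" using b[of "{j}"] j by simp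
    also have "\<dots> \<in> ideal.span (f ` (J - {j}))"
      unfolding koszul_diff_def
      by (intro ideal.span_sum, subst mult.commute) (auto intro: ideal.span_scale ideal.span_base)
    finally show ?thesis .
  qed
  then show ?thesis by blast
qed

lemma ideal_span_image:
  assumes "p \<in> ideal.span (f ` J)" "finite J"
  obtains \<mu> where "p = (\<Sum>j\<in>J. f j * \<mu> j)"
proof -
  let ?I = "range (\<lambda>\<mu>. \<Sum>j\<in>J. f j * \<mu> j)"
  have "ideal.span (f ` J) \<subseteq> ?I"
  proof (rule ideal.span_minimal)
    show "f ` J \<subseteq> ?I"
    proof
      fix y assume "y \<in> f ` J"
      then obtain i where i: "i \<in> J" "y = f i" by blast
      then have "y = (\<Sum>j\<in>J. f j * (if j = i then 1 else 0))"
        using assms(2) by (simp add: if_distrib[of "\<lambda>x. _ * x"] cong: if_cong)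
      then show "y \<in> ?I"
        by (rule range_eqI[of y "\<lambda>\<mu>. \<Sum>j\<in>J. f j * \<mu> j" "\<lambda>j. if j = i then 1 else 0"])
    qed
    show "ideal.subspace ?I"
    proof (rule ideal.subspaceI)
      show "0 \<in> ?I" by (rule range_eqI[of _ _ "\<lambda>_. 0"]) simp
      show "x + y \<in> ?I" if "x \<in> ?I" "y \<in> ?I" for x y
      proof -
        from that obtain \<mu> \<nu> where "x = (\<Sum>j\<in>J. f j * \<mu> j)" "y = (\<Sum>j\<in>J. f j * \<nu> j)" by auto
        then show ?thesis
          by (intro range_eqI[of _ _ "\<lambda>j. \<mu> j + \<nu> j"]) (simp add: distrib_left sum.distrib)
      qed
      show "a * x \<in> ?I" if "x \<in> ?I" for a x
      proof -
        from that obtain \<mu> where "x = (\<Sum>j\<in>J. f j * \<mu> j)" by auto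
        then show ?thesis
          by (intro range_eqI[of _ _ "\<lambda>j. a * \<mu> j"]) (simp add: sum_distrib_left mult_ac)
      qed
    qed
  qed
  then show ?thesis using assms(1) that by blast
qed

section \<open>Powers of the variables as a regular sequence\<close>

lemma keys_monomial_mult:
  fixes p :: "('k::comm_ring_1, 'n) mpoly"
  shows "Poly_Mapping.keys (Poly_Mapping.single a 1 * p) = (\<lambda>m. a + m) ` Poly_Mapping.keys p"
proof -
  have "Poly_Mapping.single a 1 * p
      = (\<Sum>m\<in>Poly_Mapping.keys p. Poly_Mapping.single (a + m) (Poly_Mapping.lookup p m))"
    by (subst mpoly_monomials[of p, symmetric]) (simp add: sum_distrib_left mult_single)
  then have lookup: "Poly_Mapping.lookup (Poly_Mapping.single a 1 * p) n
      = (\<Sum>m\<in>Poly_Mapping.keys p. if a + m = n then Poly_Mapping.lookup p m else 0)" for n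
    by (simp add: lookup_sum lookup_single when_def)
  show ?thesis
  proof (intro equalityI subsetI)
    fix n assume "n \<in> Poly_Mapping.keys (Poly_Mapping.single a 1 * p)"
    then have "(\<Sum>m\<in>Poly_Mapping.keys p. if a + m = n then Poly_Mapping.lookup p m else 0) \<noteq> 0"
      by (simp add: in_keys_iff lookup)
    then obtain m where "m \<in> Poly_Mapping.keys p" "(if a + m = n then Poly_Mapping.lookup p m else 0) \<noteq> 0"
      by (rule sum.not_neutral_contains_not_neutral)
    then show "n \<in> (\<lambda>m. a + m) ` Poly_Mapping.keys p" by (auto split: if_splits)
  next
    fix n assume "n \<in> (\<lambda>m. a + m) ` Poly_Mapping.keys p"
    then obtain m where m: "m \<in> Poly_Mapping.keys p" "n = a + m" by blast
    then show "n \<in> Poly_Mapping.keys (Poly_Mapping.single a 1 * p)"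
      by (simp add: in_keys_iff lookup)
  qed
qed

text \<open>The regular sequence is \<open>X i ^ N\<close> over all variables in some order. Its
  initial segments generate monomial ideals; describing these by exponents lets regularity be read
  off from the keys.\<close>

lemma mpoly_syzygy:
  fixes f :: "'j \<Rightarrow> ('k::comm_ring_1, 'n::finite) mpoly"
  assumes J: "finite J" "card J \<le> CARD('n)" and char: "\<And>p :: ('k, 'n) mpoly. p + p = 0"
    and q: "\<And>i. q * X i ^ N \<in> ideal.span (f ` J)"
    and c: "(\<Sum>j\<in>J. f j * c j) = 0"
  shows "\<exists>m. \<forall>j\<in>J. q ^ m * c j \<in> ideal.span (f ` (J - {j}))"
proof -
  obtain e :: "nat \<Rightarrow> 'n" where e: "bij_betw e {0..<CARD('n)} UNIV"
    using ex_bij_betw_nat_finite[of "UNIV :: 'n set"] by auto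
  have "\<forall>k. \<exists>\<mu>. q * X (e k) ^ N = (\<Sum>j\<in>J. f j * \<mu> j)"
    using ideal_span_image[OF q J(1)] by metis
  then obtain \<mu> where \<mu>: "\<And>k. q * X (e k) ^ N = (\<Sum>j\<in>J. f j * \<mu> k j)" by metis
  define I :: "nat \<Rightarrow> ('k, 'n) mpoly set" where
    "I k = {p. \<forall>m\<in>Poly_Mapping.keys p. \<exists>i<k. N \<le> Poly_Mapping.lookup m (e i)}" for k
  have add: "p + p' \<in> I k" if "p \<in> I k" "p' \<in> I k" for p p' k
    using that keys_add[of p p'] by (auto simp: I_def)
  have sub: "ideal.subspace (I k)" for k
  proof (rule ideal.subspaceI)
    show "0 \<in> I k" by (simp add: I_def)
    show "a * p \<in> I k" if "p \<in> I k" for a p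
    proof -
      have "\<exists>i<k. N \<le> Poly_Mapping.lookup m (e i)" if "m \<in> Poly_Mapping.keys (a * p)" for m
      proof -
        from that keys_mult[of a p] obtain u v where "m = u + v" "v \<in> Poly_Mapping.keys p" by blast
        then show ?thesis using \<open>p \<in> I k\<close> by (fastforce simp: I_def lookup_add)
      qed
      then show ?thesis by (simp add: I_def)
    qed
  qed (rule add)
  show ?thesis
  proof (rule koszul_syzygy[where n = "CARD('n)" and I = I and x = "\<lambda>k. X (e k) ^ N" and \<mu> = \<mu>])
    show "I 0 = {0}" by (auto simp: I_def)
    fix k assume k: "k < CARD('n)"
    have inj: "e i \<noteq> e k" if "i < k" for i
      using e k that by (auto simp: bij_betw_def dest!: inj_onD)
    show "y \<in> I k" if y: "X (e k) ^ N * y \<in> I k" for y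
      unfolding I_def
    proof (intro CollectI ballI)
      fix m assume "m \<in> Poly_Mapping.keys y"
      then have "Poly_Mapping.single (e k) N + m \<in> Poly_Mapping.keys (X (e k) ^ N * y)"
        by (simp add: X_power keys_monomial_mult)
      then show "\<exists>i<k. N \<le> Poly_Mapping.lookup m (e i)"
        using y inj by (fastforce simp: I_def lookup_add lookup_single when_def)
    qed
    show "z \<in> I (Suc k) \<longleftrightarrow> (\<exists>y. z - X (e k) ^ N * y \<in> I k)" for z
    proof
      assume z: "z \<in> I (Suc k)"
      let ?K = "{m \<in> Poly_Mapping.keys z. N \<le> Poly_Mapping.lookup m (e k)}"
      let ?s = "\<lambda>m. Poly_Mapping.single m (Poly_Mapping.lookup z m)"
      have "X (e k) ^ N * Poly_Mapping.single (m - Poly_Mapping.single (e k) N) (Poly_Mapping.lookup z m) = ?s m"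
        if "m \<in> ?K" for m
      proof -
        have "Poly_Mapping.single (e k) N + (m - Poly_Mapping.single (e k) N) = m"
          using that by (intro poly_mapping_eqI) (auto simp: lookup_add lookup_minus lookup_single when_def)
        then show ?thesis by (simp add: X_power mult_single)
      qed
      then have eq: "X (e k) ^ N * (\<Sum>m\<in>?K. Poly_Mapping.single (m - Poly_Mapping.single (e k) N) (Poly_Mapping.lookup z m))
          = (\<Sum>m\<in>?K. ?s m)"
        unfolding sum_distrib_left by (rule sum.cong[OF refl])
      have "z - (\<Sum>m\<in>?K. ?s m) \<in> I k"
      proof -
        have "z - (\<Sum>m\<in>?K. ?s m) = (\<Sum>m\<in>Poly_Mapping.keys z - ?K. ?s m)"
          using mpoly_monomials[of z] sum_diff[of "Poly_Mapping.keys z" ?K ?s] by simp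
        moreover have "?s m \<in> I k" if "m \<in> Poly_Mapping.keys z - ?K" for m
          using z that less_Suc_eq by (auto simp: I_def)
        ultimately show ?thesis by (auto intro!: ideal.subspace_sum[OF sub])
      qed
      then show "\<exists>y. z - X (e k) ^ N * y \<in> I k" unfolding eq[symmetric] ..
    next
      assume "\<exists>y. z - X (e k) ^ N * y \<in> I k"
      then obtain y where "z - X (e k) ^ N * y \<in> I k" by blast
      then have "z - X (e k) ^ N * y \<in> I (Suc k)" by (force simp: I_def less_Suc_eq)
      moreover have "X (e k) ^ N * y \<in> I (Suc k)"
        by (auto simp: I_def X_power keys_monomial_mult lookup_add)
      ultimately show "z \<in> I (Suc k)" using add by fastforce
    qed
  qed (use J char sub \<mu> c in auto)
qed

section \<open>Algebraic dependence\<close>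

lemma card_bounded_exponents:
  fixes B defines "B \<equiv> \<lambda>t. {m :: 'n::finite \<Rightarrow>\<^sub>0 nat. \<forall>i. Poly_Mapping.lookup m i < t}"
  shows "finite (B t)" "card (B t) = t ^ CARD('n)"
proof -
  have "bij_betw Poly_Mapping.lookup (B t) (UNIV \<rightarrow>\<^sub>E {..<t})"
  proof (rule bij_betwI[where g = Abs_poly_mapping])
    show "Poly_Mapping.lookup \<in> B t \<rightarrow> UNIV \<rightarrow>\<^sub>E {..<t}" by (auto simp: B_def)
    show "Abs_poly_mapping \<in> (UNIV \<rightarrow>\<^sub>E {..<t}) \<rightarrow> B t" by (auto simp: B_def)
  qed (simp_all add: poly_mapping_eqI)
  then show "finite (B t)" "card (B t) = t ^ CARD('n)"
    by (simp_all add: bij_betw_finite bij_betw_same_card card_PiE finite_PiE)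
qed

text \<open>A dimension count: there are \<open>t ^ CARD('m)\<close> monomials in the
  \<open>h j\<close> with exponents below \<open>t\<close>, but they lie in a space of dimension at
  most \<open>(t * E) ^ CARD('n)\<close>.\<close>

lemma algebraic_dependence:
  fixes h :: "'m::finite \<Rightarrow> ('k::field, 'n::finite) mpoly"
  assumes "CARD('n) < CARD('m)"
  shows "\<exists>\<Phi> :: ('k, 'm) mpoly. \<Phi> \<noteq> 0 \<and> poly_subst Const h \<Phi> = 0"
proof -
  let ?L = "poly_subst Const h"
  interpret L: cring_hom ?L
    by (intro cring_hom_poly_subst cring_hom_Const)
  define bdd where "bdd d p \<longleftrightarrow> (\<forall>m\<in>Poly_Mapping.keys p. \<forall>i. Poly_Mapping.lookup m i \<le> d)"
    for d and p :: "('k, 'n) mpoly"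
  have bdd_mult: "bdd (d + d') (p * p')" if "bdd d p" "bdd d' p'" for d d' p p'
    unfolding bdd_def
  proof
    fix m assume "m \<in> Poly_Mapping.keys (p * p')"
    then obtain a b where "m = a + b" "a \<in> Poly_Mapping.keys p" "b \<in> Poly_Mapping.keys p'"
      using keys_mult[of p p'] by blast
    then show "\<forall>i. Poly_Mapping.lookup m i \<le> d + d'"
      using that by (auto simp: bdd_def lookup_add intro: add_mono)
  qed
  have bdd_1: "bdd 0 1" by (simp add: bdd_def)
  have bdd_power: "bdd (n * d) (p ^ n)" if "bdd d p" for n d p
    by (induction n) (use bdd_1 bdd_mult[OF that] in auto)
  have bdd_prod: "bdd (sum d S) (\<Prod>j\<in>S. p j)" if "\<And>j. j \<in> S \<Longrightarrow> bdd (d j) (p j)" for d p and S :: "'m set"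
    using that by (induction S rule: infinite_finite_induct) (auto intro: bdd_1 bdd_mult)
  obtain D where D: "\<And>j. bdd D (h j)"
  proof
    let ?K = "(\<Union>j. Poly_Mapping.keys (h j)) \<times> (UNIV :: 'n set)"
    show "bdd (\<Sum>(m, i)\<in>?K. Poly_Mapping.lookup m i) (h j)" for j
      unfolding bdd_def
    proof (intro ballI allI)
      fix m i assume m: "m \<in> Poly_Mapping.keys (h j)"
      have "(case (m, i) of (m, i) \<Rightarrow> Poly_Mapping.lookup m i) \<le> (\<Sum>(m, i)\<in>?K. Poly_Mapping.lookup m i)"
        by (rule member_le_sum) (use m in auto)
      then show "Poly_Mapping.lookup m i \<le> (\<Sum>(m, i)\<in>?K. Poly_Mapping.lookup m i)" by simp
    qed
  qed
  \<comment> \<open>\<open>D\<close> bounds all exponents in the \<open>h j\<close>, so such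
    monomials in them have exponents below \<open>t * E\<close>. Taking \<open>t\<close> above
    \<open>E ^ CARD('n)\<close> makes even \<open>t ^ (CARD('n) + 1)\<close> exceed the dimension
    bound.\<close>
  define E where "E = CARD('m) * D + 1"
  define t where "t = E ^ CARD('n) + 1"
  let ?B = "\<lambda>t. {m :: 'm \<Rightarrow>\<^sub>0 nat. \<forall>i. Poly_Mapping.lookup m i < t}"
  let ?C = "\<lambda>t. {m :: 'n \<Rightarrow>\<^sub>0 nat. \<forall>i. Poly_Mapping.lookup m i < t}"
  define mon where "mon e = ?L (Poly_Mapping.single e 1)" for e
  have L_single: "?L (Poly_Mapping.single e a) = Const a * mon e" for e a
    by (simp add: mon_def poly_subst_single)
  \<comment> \<open>Linear dependence concerns sets, so a coincidence of two monomials in the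
    \<open>h j\<close> has to be treated first; it is itself an algebraic relation.\<close>
  show ?thesis
  proof (cases "inj_on mon (?B t)")
    case False
    then obtain e e' where e: "e \<noteq> e'" "mon e = mon e'" by (auto simp: inj_on_def)
    let ?\<Phi> = "Poly_Mapping.single e 1 - Poly_Mapping.single e' (1 :: 'k)"
    have "Poly_Mapping.lookup ?\<Phi> e = 1"
      using e(1) by (simp add: lookup_minus lookup_single_not_eq)
    then have "?\<Phi> \<noteq> 0" by force
    moreover have "?L ?\<Phi> = 0" by (simp add: L_single e(2))
    ultimately show ?thesis by blast
  next
    case inj: True
    interpret V: vector_space "\<lambda>c (p :: ('k, 'n) mpoly). Const c * p"
      by unfold_locales (simp_all only: Const.hom_add Const.hom_mult Const.hom_1 distrib_left distrib_right mult.assoc mult_1_left)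
    note V.scale_scale [simp del]
    define T :: "('k, 'n) mpoly set" where "T = (\<lambda>m. Poly_Mapping.single m 1) ` ?C (t * E)"
    have T: "finite T" "card T \<le> (t * E) ^ CARD('n)"
      using card_bounded_exponents[where 'n = 'n, of "t * E"] card_image_le[of "?C (t * E)"] by (auto simp: T_def)
    have "mon e \<in> V.span T" if e: "e \<in> ?B t" for e
    proof -
      have "bdd (\<Sum>i\<in>(UNIV :: 'm set). t * D) (\<Prod>i\<in>UNIV. h i ^ Poly_Mapping.lookup e i)"
      proof (rule bdd_prod)
        fix j :: 'm
        have "Poly_Mapping.lookup e j < t" using e by simp
        then have "Poly_Mapping.lookup e j * D \<le> t * D" by simp
        then show "bdd (t * D) (h j ^ Poly_Mapping.lookup e j)"
          using bdd_power[OF D, of "Poly_Mapping.lookup e j" j] unfolding bdd_def by (meson order_trans)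
      qed
      then have "bdd (CARD('m) * (t * D)) (mon e)" by (simp add: mon_def poly_subst_single)
      moreover have "CARD('m) * (t * D) < t * E" by (simp add: E_def t_def algebra_simps)
      ultimately have keys: "Poly_Mapping.keys (mon e) \<subseteq> ?C (t * E)"
        unfolding bdd_def using le_less_trans by blast
      have "(\<Sum>m\<in>Poly_Mapping.keys (mon e). Const (Poly_Mapping.lookup (mon e) m) * Poly_Mapping.single m 1) \<in> V.span T"
        using keys by (intro V.span_sum V.span_scale V.span_base) (auto simp: T_def)
      also have "(\<Sum>m\<in>Poly_Mapping.keys (mon e). Const (Poly_Mapping.lookup (mon e) m) * Poly_Mapping.single m 1) = mon e"
        using mpoly_monomials[of "mon e"] by (simp add: Const_def mult_single)
      finally show ?thesis .
    qed
    then have sub: "mon ` ?B t \<subseteq> V.span T" by blast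
    have "card (mon ` ?B t) = t ^ CARD('m)"
      using card_bounded_exponents[where 'n = 'm, of t] by (simp add: card_image inj)
    moreover have "(t * E) ^ CARD('n) < t ^ CARD('m)"
    proof -
      have "(t * E) ^ CARD('n) = t ^ CARD('n) * E ^ CARD('n)" by (simp add: power_mult_distrib)
      also have "\<dots> < t ^ CARD('n) * t" by (simp add: t_def)
      also have "\<dots> = t ^ Suc (CARD('n))" by simp
      also have "\<dots> \<le> t ^ CARD('m)" using assms by (intro power_increasing) (auto simp: t_def)
      finally show ?thesis .
    qed
    ultimately have "V.dependent (mon ` ?B t)"
      using V.independent_span_bound[OF T(1) _ sub] T(2) by fastforce
    then obtain S u v where S: "finite S" "S \<subseteq> mon ` ?B t" "(\<Sum>v\<in>S. Const (u v) * v) = 0" "v \<in> S" "u v \<noteq> 0"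
      unfolding V.dependent_explicit by blast
    let ?g = "inv_into (?B t) mon"
    have g: "mon (?g v) = v" if "v \<in> S" for v
      using that S(2) by (auto intro: f_inv_into_f)
    let ?\<Phi> = "\<Sum>v\<in>S. Poly_Mapping.single (?g v) (u v)"
    have "?L ?\<Phi> = (\<Sum>v\<in>S. Const (u v) * v)"
      by (simp add: L_single g)
    moreover have "Poly_Mapping.lookup ?\<Phi> (?g v) = u v"
    proof -
      have "Poly_Mapping.lookup ?\<Phi> (?g v) = (\<Sum>w\<in>S. if w = v then u v else 0)"
        unfolding lookup_sum
      proof (intro sum.cong refl)
        fix w assume "w \<in> S"
        then show "Poly_Mapping.lookup (Poly_Mapping.single (?g w) (u w)) (?g v) = (if w = v then u v else 0)"
          using g[of w] g[OF S(4)] by (auto simp: lookup_single when_def)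
      qed
      then show ?thesis using S by simp
    qed
    ultimately show ?thesis
      using S by (intro exI[of _ ?\<Phi>]) auto
  qed
qed

text \<open>The Nullstellensatz for the zero ideal. The order on the index type makes the polynomial
  ring a domain, so no power of \<open>p\<close> is zero.\<close>

lemma mpoly_nonroot:
  fixes p :: "('k::alg_closed_field, 'n::{finite, linorder}) mpoly"
  assumes "p \<noteq> 0"
  obtains v where "peval p v \<noteq> 0"
proof -
  have "p ^ n \<notin> ideal.span {}" for n using assms by simp
  then show ?thesis using nullstellensatz[of "{}" p] that by blast
qed

section \<open>The action of \<open>G\<close>\<close>

lemma exhaust_7:
  fixes x :: 7
  shows "x = 1 \<or> x = 2 \<or> x = 3 \<or> x = 4 \<or> x = 5 \<or> x = 6 \<or> x = 7"
proof (induct x)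
  case (of_int z)
  then have "z = 0 \<or> z = 1 \<or> z = 2 \<or> z = 3 \<or> z = 4 \<or> z = 5 \<or> z = 6" by fastforce
  then show ?case by auto
qed

lemma forall_7: "(\<forall>i :: 7. P i) \<longleftrightarrow> P 1 \<and> P 2 \<and> P 3 \<and> P 4 \<and> P 5 \<and> P 6 \<and> P 7"
  by (metis exhaust_7)

lemma UNIV_7: "(UNIV :: 7 set) = {1, 2, 3, 4, 5, 6, 7}"
  using exhaust_7 by auto

lemma sum_7: "sum f (UNIV :: 7 set) = f 1 + f 2 + f 3 + f 4 + f 5 + f 6 + f 7"
  unfolding UNIV_7 by (simp add: ac_simps)

lemma vector_7 [simp]:
  "(vector [a, b, c, d, e, f, g] :: 'a::zero ^ 7) $ 1 = a"
  "(vector [a, b, c, d, e, f, g] :: 'a::zero ^ 7) $ 2 = b"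
  "(vector [a, b, c, d, e, f, g] :: 'a::zero ^ 7) $ 3 = c"
  "(vector [a, b, c, d, e, f, g] :: 'a::zero ^ 7) $ 4 = d"
  "(vector [a, b, c, d, e, f, g] :: 'a::zero ^ 7) $ 5 = e"
  "(vector [a, b, c, d, e, f, g] :: 'a::zero ^ 7) $ 6 = f"
  "(vector [a, b, c, d, e, f, g] :: 'a::zero ^ 7) $ 7 = g"
  "(vector [a, b, c, d, e, f, g] :: 'a::zero ^ 7) $ 0 = g"
  unfolding vector_def by simp_all

lemma char_2_two:
  assumes "CHAR('k::comm_ring_1) = 2"
  shows "(2 :: 'k) = 0"
  using of_nat_CHAR[where 'a = 'k] assms by simp

lemma char_2_add_self: "CHAR('k::comm_ring_1) = 2 \<Longrightarrow> (x :: 'k) + x = 0"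
  by (metis char_2_two mult_2 mult_zero_left)

lemma mpoly_char_2_add_self:
  assumes "CHAR('k::comm_ring_1) = 2"
  shows "(p :: ('k, 'n) mpoly) + p = 0"
  by (rule poly_mapping_eqI) (simp only: lookup_add lookup_zero char_2_add_self[OF assms])

text \<open>Parametrising \<open>G\<close> by vectors over F_2 turns composition into addition and
  products over the group into products over \<open>UNIV\<close>.\<close>

definition act :: "bit ^ 4 \<Rightarrow> 'k::comm_ring_1 ^ 7 \<Rightarrow> 'k ^ 7" where
  "act a v = vector [v $ 1, v $ 2, v $ 3, v $ 4,
     v $ 5 + of_bit (a $ 1) * v $ 1 + of_bit (a $ 4) * v $ 4,
     v $ 6 + of_bit (a $ 2) * v $ 2 + of_bit (a $ 4) * v $ 4,
     v $ 7 + of_bit (a $ 3) * v $ 3 + of_bit (a $ 4) * v $ 4]"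

abbreviation gmat :: "bit ^ 4 \<Rightarrow> bit ^ 7 ^ 7" where
  "gmat a \<equiv> G_mat (a $ 1) (a $ 2) (a $ 3) (a $ 4)"

lemma G_eq: "G = range gmat"
proof -
  have "G_mat a1 a2 a3 a4 \<in> range gmat" for a1 a2 a3 a4
    by (rule range_eqI[of _ _ "vector [a1, a2, a3, a4]"]) (simp add: vector_def)
  then show ?thesis by (auto simp: G_def)
qed

lemma gmat_act: "extend_scalars (gmat a) *v v = act a v"
  by (simp add: vec_eq_iff forall_7 matrix_vector_mult_def sum_7 extend_scalars_def G_mat_def act_def)

lemma gmat_square: "gmat a ** gmat a = mat 1"
  by (simp add: vec_eq_iff forall_7 matrix_matrix_mult_def sum_7 G_mat_def mat_def)

lemma matrix_inv_gmat: "matrix_inv (gmat a) = gmat a"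
proof -
  let ?A = "gmat a" and ?B = "matrix_inv (gmat a)"
  have "?A ** ?B = mat 1 \<and> ?B ** ?A = mat 1"
    unfolding matrix_inv_def by (rule someI[of _ ?A]) (simp add: gmat_square)
  then have "?B = (?A ** ?A) ** ?B" by (simp add: gmat_square)
  also have "\<dots> = ?A" using \<open>?A ** ?B = mat 1 \<and> _\<close> by (simp add: matrix_mul_assoc[symmetric])
  finally show ?thesis .
qed

lemma act_act:
  assumes "CHAR('k::comm_ring_1) = 2"
  shows "act a (act b v) = act (a + b) (v :: 'k ^ 7)"
  by (simp add: vec_eq_iff forall_7 act_def char_2_two[OF assms] algebra_simps)

lemma act_0 [simp]: "act 0 v = v"
  by (simp add: vec_eq_iff forall_7 act_def)

lemma bit_vec_add_self [simp]: "(a :: bit ^ 'n) + a = 0"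
  by (simp add: vec_eq_iff)

lemma finite_bit_vec: "finite (A :: (bit ^ 'n) set)"
proof (rule finite_subset)
  have "a = (\<chi> i. of_bool (a $ i = 1))" for a :: "bit ^ 'n"
    by (simp add: vec_eq_iff)
  then show "A \<subseteq> range (\<lambda>f :: 'n \<Rightarrow> bool. \<chi> i. of_bool (f i))" by (metis rangeI subsetI)
qed simp

lemma orbit_G: "orbit G v = range (\<lambda>a. act a v)"
  by (simp add: orbit_def Setcompr_eq_image G_eq image_image gmat_act)

lemma orbit_G_eq:
  assumes "CHAR('k::comm_ring_1) = 2" "w = act a (v :: 'k ^ 7)"
  shows "orbit G v = orbit G w"
proof -
  have "act b v = act (b + a) w" "act b w = act (b + a) v" for b
    using assms by (simp_all add: act_act add.assoc)
  then show ?thesis unfolding orbit_G by (metis (no_types) image_subsetI rangeI subset_antisym)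
qed

lemma peval_poly_act:
  "peval (poly_act g p) v = peval p (extend_scalars (matrix_inv g) *v v)"
  by (simp add: poly_act_def peval_poly_subst matrix_vector_mult_def)

lemma peval_gmat: "peval (poly_act (gmat a) p) v = peval p (act a v)"
  by (simp add: peval_poly_act matrix_inv_gmat gmat_act)

lemma mpoly_eqI:
  fixes p q :: "('k::alg_closed_field, 'n::{finite, linorder}) mpoly"
  assumes "\<And>v. peval p v = peval q v"
  shows "p = q"
  using mpoly_nonroot[of "p - q"] assms by auto

lemma invariants_G_iff:
  fixes p :: "('k::alg_closed_field, 7) mpoly"
  shows "p \<in> invariants G \<longleftrightarrow> (\<forall>a v. peval p (act a v) = peval p v)"
proof -
  have "poly_act (gmat a) p = p \<longleftrightarrow> (\<forall>v. peval p (act a v) = peval p v)" for a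
    using mpoly_eqI[of "poly_act (gmat a) p" p] peval_gmat[of a p] by metis
  then show ?thesis by (auto simp: invariants_def G_eq)
qed

text \<open>
  If \<open>v\<close> is not in the orbit of \<open>w\<close>, some linear form takes a value at \<open>v\<close> that it does not take on the
  orbit of \<open>w\<close>. The product of its translates, shifted by that value, is an invariant that
  vanishes at \<open>v\<close> but not at \<open>w\<close>.
\<close>

lemma invariants_separate_orbits:
  fixes v w :: "'k::alg_closed_field ^ 7"
  assumes char: "CHAR('k) = 2" and inv: "\<And>p. p \<in> invariants G \<Longrightarrow> peval p v = peval p w"
  shows "\<exists>a. v = act a w"
proof (rule ccontr)
  assume neq: "\<not> (\<exists>a. v = act a w)"
  \<comment> \<open>The linear form has coefficients 1, \<open>s\<close>, ..., \<open>s ^ 6\<close>;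
    its value at \<open>u\<close> is that of the polynomial \<open>?P u\<close> at \<open>s\<close>.
    A common nonroot \<open>s\<close> of finitely many nonzero polynomials therefore suits the whole
    orbit of \<open>w\<close>.\<close>
  let ?P = "\<lambda>u :: 'k ^ 7. [:u $ 1, u $ 2, u $ 3, u $ 4, u $ 5, u $ 6, u $ 7:]"
  have nz: "?P (act a w - v) \<noteq> 0" for a
  proof
    assume "?P (act a w - v) = 0"
    then have "act a w = v" by (simp add: vec_eq_iff forall_7)
    then show False using neq by blast
  qed
  have "(\<Prod>a\<in>UNIV. ?P (act a w - v)) \<noteq> 0"
    unfolding prod_zero_iff[OF finite_bit_vec] using nz by blast
  then obtain s where "poly (\<Prod>a\<in>UNIV. ?P (act a w - v)) s \<noteq> 0" by (rule ex_nonroot)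
  then have s: "poly (?P (act a w - v)) s \<noteq> 0" for a
    unfolding poly_prod prod_zero_iff[OF finite_bit_vec] by blast
  define p :: "('k, 7) mpoly" where
    "p = X 1 + Const s * (X 2 + Const s * (X 3 + Const s * (X 4 + Const s * (X 5 + Const s * (X 6 + Const s * X 7)))))
       - Const (poly (?P v) s)"
  have p: "peval p u = poly (?P (u - v)) s" for u
    by (simp add: p_def algebra_simps)
  define N where "N = (\<Prod>a\<in>UNIV. poly_act (gmat a) p)"
  have N: "peval N u = (\<Prod>a\<in>UNIV. peval p (act a u))" for u
    by (simp add: N_def peval_gmat)
  have "peval N (act b u) = peval N u" for b u
    unfolding N act_act[OF char]
    by (rule prod.reindex_bij_witness[of _ "\<lambda>a. a + b" "\<lambda>a. a + b"]) (simp_all add: add.assoc)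
  then have "N \<in> invariants G" by (simp add: invariants_G_iff)
  then have "peval N w = peval N v" using inv by simp
  moreover have "peval N v = 0"
    unfolding N by (intro prod_zero[OF finite_bit_vec] bexI[of _ 0]) (simp_all add: p)
  moreover have "peval N w \<noteq> 0"
    unfolding N p prod_zero_iff[OF finite_bit_vec] using s by blast
  ultimately show False by simp
qed

lemma separating_setD:
  fixes v w :: "'k::alg_closed_field ^ 7"
  assumes "CHAR('k) = 2" "separating_set G E" "\<And>p. p \<in> E \<Longrightarrow> peval p v = peval p w"
  shows "\<exists>a. v = act a w"
proof -
  have "orbit G v = orbit G w" using assms(2,3) unfolding separating_set_def by metis
  moreover have "v \<in> orbit G v" unfolding orbit_G by (rule range_eqI[of _ _ 0]) simp
  ultimately show ?thesis by (auto simp: orbit_G)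
qed

lemma peval_zero_span:
  assumes "p \<in> ideal.span S" "\<And>f. f \<in> S \<Longrightarrow> peval f v = 0"
  shows "peval p v = 0"
proof -
  have "ideal.span S \<subseteq> {f. peval f v = 0}"
    by (rule ideal.span_minimal) (use assms(2) in \<open>auto intro!: ideal.subspaceI\<close>)
  then show ?thesis using assms(1) by blast
qed

lemma cong_mod_ideal_peval:
  assumes "cong_mod_ideal p q S" "\<And>f. f \<in> S \<Longrightarrow> peval f v = 0"
  shows "peval p v = peval q v"
  using peval_zero_span[of "p - q" S v] assms by (simp add: cong_mod_ideal_def)

section \<open>Eight invariants do not separate\<close>

lemma peval_line:
  fixes p :: "('k::comm_ring_1, 'n::finite) mpoly"
  obtains P where "\<And>t. poly P t = peval p (u + t *s d)"
proof
  fix t :: 'k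
  interpret cring_hom "\<lambda>P. poly P t" by unfold_locales auto
  show "poly (poly_subst (\<lambda>c. [:c:]) (\<lambda>i. [:u $ i, d $ i:]) p) t = peval p (u + t *s d)"
    by (simp add: hom_poly_subst) (simp add: peval_def)
qed

text \<open>Replaces continuity: the restriction to the line has infinitely many roots.\<close>

lemma peval_zero_limit:
  fixes p :: "('k::alg_closed_field, 'n::finite) mpoly"
  assumes "\<And>t. t \<noteq> 0 \<Longrightarrow> peval p (t *s d) = 0"
  shows "peval p 0 = 0"
proof -
  obtain P where P: "\<And>t. poly P t = peval p (0 + t *s d)" using peval_line by blast
  have "infinite (UNIV - {0 :: 'k})" using infinite_UNIV_alg_closed by simp
  moreover have "UNIV - {0} \<subseteq> {t. poly P t = 0}" using assms by (auto simp: P)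
  ultimately have "infinite {t. poly P t = 0}" using finite_subset by blast
  then have "P = 0" using poly_roots_finite by blast
  then show ?thesis using P[of 0] by simp
qed

text \<open>
  Choose a line through \<open>H v0\<close> not contained in the hypersurface \<open>\<Phi> = 0\<close>, which contains
  the image of \<open>H = (h 1, \<dots>)\<close>; projecting along this line drops one of the \<open>h j\<close> but keeps the fibre through \<open>v0\<close> finite.
\<close>

lemma finite_fibre_projection:
  fixes h :: "'m::{finite, linorder} \<Rightarrow> ('k::alg_closed_field, 'n::finite) mpoly"
  assumes card: "CARD('n) < CARD('m)"
    and fibres: "\<And>v. finite {w. \<forall>j. peval (h j) w = peval (h j) v}"
  shows "\<exists>s \<theta> c. (\<forall>j. h j = \<theta> j + Const (c j) * h s)
    \<and> finite {w. \<forall>j. j \<noteq> s \<longrightarrow> peval (\<theta> j) w = peval (\<theta> j) v0}"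
proof -
  obtain \<Phi> :: "('k, 'm) mpoly" where \<Phi>: "\<Phi> \<noteq> 0" "poly_subst Const h \<Phi> = 0"
    using algebraic_dependence[OF card] by blast
  define H where "H v = (\<chi> j. peval (h j) v)" for v
  have H: "peval \<Phi> (H v) = 0" for v
    using arg_cong[OF \<Phi>(2), of "\<lambda>p. peval p v"] by (simp add: peval_poly_subst H_def)
  obtain p where p: "peval \<Phi> p \<noteq> 0" using mpoly_nonroot[OF \<Phi>(1)] .
  define d where "d = p - H v0"
  have "d \<noteq> 0" using p H[of v0] by (auto simp: d_def)
  then obtain s where s: "d $ s \<noteq> 0" by (auto simp: vec_eq_iff)
  \<comment> \<open>Chosen so that the forms giving \<open>\<theta> j\<close> vanish on the
    direction \<open>d\<close>; in particular \<open>c s = 1\<close> and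
    \<open>\<theta> s = 0\<close>.\<close>
  define c where "c j = d $ j / d $ s" for j
  define \<theta> where "\<theta> j = h j - Const (c j) * h s" for j
  obtain P where P: "\<And>t. poly P t = peval \<Phi> (H v0 + t *s d)" using peval_line by blast
  \<comment> \<open>At parameter 1 the line passes through \<open>p\<close>, off the hypersurface.
    So it meets the hypersurface in finitely many points, and each has a finite fibre under
    \<open>H\<close>.\<close>
  have "P \<noteq> 0" using P[of 1] p by (auto simp: d_def)
  then have roots: "finite {t. poly P t = 0}" by (rule poly_roots_finite)
  let ?F = "\<lambda>t. {w. H w = H v0 + t *s d}"
  have "finite (?F t)" for t
  proof (cases "?F t = {}")
    case False
    then obtain v where v: "H v = H v0 + t *s d" by blast
    have "?F t = {w. \<forall>j. peval (h j) w = peval (h j) v}"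
      unfolding v[symmetric] by (simp add: H_def vec_eq_iff)
    then show ?thesis using fibres by simp
  qed simp
  then have fin: "finite (\<Union>t\<in>{t. poly P t = 0}. ?F t)" using roots by blast
  have "{w. \<forall>j. j \<noteq> s \<longrightarrow> peval (\<theta> j) w = peval (\<theta> j) v0} \<subseteq> (\<Union>t\<in>{t. poly P t = 0}. ?F t)"
  proof
    fix w assume "w \<in> {w. \<forall>j. j \<noteq> s \<longrightarrow> peval (\<theta> j) w = peval (\<theta> j) v0}"
    then have w: "peval (\<theta> j) w = peval (\<theta> j) v0" if "j \<noteq> s" for j using that by blast
    define t where "t = (peval (h s) w - peval (h s) v0) / d $ s"
    have "peval (h j) w = peval (h j) v0 + t * d $ j" for j
    proof (cases "j = s")
      case False
      from w[OF this] have "peval (h j) w = peval (h j) v0 + c j * (peval (h s) w - peval (h s) v0)"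
        by (simp add: \<theta>_def algebra_simps)
      then show ?thesis by (simp add: c_def t_def)
    qed (use s in \<open>simp add: t_def\<close>)
    then have "w \<in> ?F t" by (simp add: H_def vec_eq_iff)
    moreover from this have "poly P t = 0" using H[of w] by (simp add: P)
    ultimately show "w \<in> (\<Union>t\<in>{t. poly P t = 0}. ?F t)" by blast
  qed
  then have "finite {w. \<forall>j. j \<noteq> s \<longrightarrow> peval (\<theta> j) w = peval (\<theta> j) v0}"
    using fin finite_subset by blast
  moreover have "h j = \<theta> j + Const (c j) * h s" for j by (simp add: \<theta>_def)
  ultimately show ?thesis by blast
qed

section \<open>The idempotent and its coboundary\<close>

lemma power_two_power_add:
  fixes x y :: "'a::comm_ring_1"
  assumes "\<And>z :: 'a. z + z = 0"
  shows "(x + y) ^ (2 ^ n) = x ^ (2 ^ n) + y ^ (2 ^ n)"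
proof (induction n)
  case (Suc n)
  have sq: "(a + b)\<^sup>2 = a\<^sup>2 + b\<^sup>2" for a b :: 'a
  proof -
    have "(a + b)\<^sup>2 = a\<^sup>2 + b\<^sup>2 + (a * b + a * b)" by (simp add: power2_eq_square algebra_simps)
    then show ?thesis by (simp only: assms add_0_right)
  qed
  have "z ^ 2 ^ Suc n = (z ^ 2 ^ n)\<^sup>2" for z :: 'a by (simp add: power_mult[symmetric] mult.commute)
  then show ?case by (simp only: Suc.IH sq)
qed simp

text \<open>
  The class of the cochain \<open>A i ^ 2 / x i ^ 2\<close> is idempotent modulo \<open>\<delta>\<close>; its coboundary is \<open>\<delta>\<close> times
  the cochain \<open>\<kappa> i j / (x i * x j) ^ 2\<close>, which is a cocycle because the
  terms of its coboundary vanish in pairs, by \<open>cocycle_pair\<close>.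
\<close>

lemma cocycle_pair:
  fixes P :: "'a::comm_ring_1"
  assumes I: "ideal.subspace I" and char: "\<And>z :: 'a. z + z = 0"
    and "P * Y - c * \<delta> \<in> I" "Q * Y - c' * \<delta> \<in> I"
  shows "P * Q * Y * (Q * c + P * c') \<in> I"
proof -
  note Iadd = ideal.subspace_add[OF I] and Imul = ideal.subspace_scale[OF I] and Isub = ideal.subspace_diff[OF I]
  let ?E = "P * Y - c * \<delta>" and ?E' = "Q * Y - c' * \<delta>"
  have "P * (Q * c + P * c') * ?E' - P * c' * (Q * ?E + P * ?E') \<in> I"
    by (rule Isub[OF Imul[OF assms(4)] Imul[OF Iadd[OF Imul[OF assms(3)] Imul[OF assms(4)]]]])
  also have "P * (Q * c + P * c') * ?E' - P * c' * (Q * ?E + P * ?E')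
      = P * Q * Y * (Q * c + P * c') - (P * c' * P * Q * Y + P * c' * P * Q * Y)"
    by (simp add: algebra_simps)
  finally show ?thesis by (simp only: char diff_0_right)
qed

text \<open>Without the squares, the coboundary of \<open>A i / x i\<close> is \<delta> times
  \<open>c i j + c j i\<close>, but the cocycle condition for these coefficients would follow only
  by cancelling \<delta>. Squaring yields the coefficients \<kappa>, for which it holds without any
  division.\<close>

lemma cocycle:
  fixes A B :: "'i \<Rightarrow> 'a::comm_ring_1"
  assumes I: "ideal.subspace I" and char: "\<And>z :: 'a. z + z = 0"
    and AB: "\<And>i j. A i * B j - c i j * \<delta> \<in> I"
    and x: "\<And>i. x i = A i + B i"
  defines "\<kappa> \<equiv> \<lambda>i j. A i * B j * c i j + A j * B i * c j i"
  shows "\<kappa> i j * x k ^ 2 + \<kappa> j k * x i ^ 2 + \<kappa> i k * x j ^ 2 \<in> I"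
    and "\<kappa> i j * \<delta> - (A i ^ 2 * x j ^ 2 + A j ^ 2 * x i ^ 2) \<in> I"
proof -
  have sq: "x i ^ 2 = A i ^ 2 + B i ^ 2" for i
    using power_two_power_add[OF char, of "A i" "B i" 1] by (simp add: x)
  note Iadd = ideal.subspace_add[OF I] and Imul = ideal.subspace_scale[OF I] and Isub = ideal.subspace_diff[OF I]
  have P: "A i * A k * B j * (A k * c i j + A i * c k j) \<in> I" for i j k
    by (rule cocycle_pair[OF I char AB AB])
  have Q: "B i * B k * A j * (B k * c j i + B i * c j k) \<in> I" for i j k
    using AB by (intro cocycle_pair[OF I char]) (simp_all add: mult.commute)
  have "A i * A k * B j * (A k * c i j + A i * c k j) + A j * A k * B i * (A k * c j i + A j * c k i)
      + A i * A j * B k * (A j * c i k + A i * c j k) + B j * B k * A i * (B k * c i j + B j * c i k)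
      + B i * B k * A j * (B k * c j i + B i * c j k) + B i * B j * A k * (B j * c k i + B i * c k j) \<in> I"
    by (intro Iadd P Q)
  also have "A i * A k * B j * (A k * c i j + A i * c k j) + A j * A k * B i * (A k * c j i + A j * c k i)
      + A i * A j * B k * (A j * c i k + A i * c j k) + B j * B k * A i * (B k * c i j + B j * c i k)
      + B i * B k * A j * (B k * c j i + B i * c j k) + B i * B j * A k * (B j * c k i + B i * c k j)
      = \<kappa> i j * x k ^ 2 + \<kappa> j k * x i ^ 2 + \<kappa> i k * x j ^ 2"
    unfolding sq \<kappa>_def by (simp add: power2_eq_square algebra_simps)
  finally show "\<kappa> i j * x k ^ 2 + \<kappa> j k * x i ^ 2 + \<kappa> i k * x j ^ 2 \<in> I" .
  have "A i * B j * (A i * B j - c i j * \<delta>) + A j * B i * (A j * B i - c j i * \<delta>) \<in> I"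
    by (intro Iadd Imul AB)
  then have "0 - (A i * B j * (A i * B j - c i j * \<delta>) + A j * B i * (A j * B i - c j i * \<delta>)) \<in> I"
    by (intro Isub ideal.subspace_0[OF I])
  also have "0 - (A i * B j * (A i * B j - c i j * \<delta>) + A j * B i * (A j * B i - c j i * \<delta>))
      = \<kappa> i j * \<delta> - (A i ^ 2 * x j ^ 2 + A j ^ 2 * x i ^ 2) + (A i ^ 2 * A j ^ 2 + A i ^ 2 * A j ^ 2)"
    unfolding sq \<kappa>_def by (simp add: power2_eq_square algebra_simps)
  finally show "\<kappa> i j * \<delta> - (A i ^ 2 * x j ^ 2 + A j ^ 2 * x i ^ 2) \<in> I"
    by (simp only: char add_0_right)
qed

text \<open>The common exponent is a power of 2 so that, in characteristic 2, raising to it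
  preserves sums.\<close>

lemma nullstellensatz_uniform:
  fixes u :: "'i \<Rightarrow> ('k::alg_closed_field, 'n::finite) mpoly"
  assumes "finite T" "\<And>i v. i \<in> T \<Longrightarrow> (\<And>p. p \<in> S \<Longrightarrow> peval p v = 0) \<Longrightarrow> peval (u i) v = 0"
  obtains n where "\<And>i. i \<in> T \<Longrightarrow> u i ^ (2 ^ n) \<in> ideal.span S"
proof -
  have "\<forall>i\<in>T. \<exists>n. u i ^ n \<in> ideal.span S"
    using nullstellensatz assms(2) by metis
  then obtain N where N: "\<And>i. i \<in> T \<Longrightarrow> u i ^ N i \<in> ideal.span S" by metis
  let ?n = "\<Sum>i\<in>T. N i"
  show ?thesis
  proof
    fix i assume i: "i \<in> T"
    have "N i \<le> ?n" using assms(1) i by (simp add: member_le_sum)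
    also have "\<dots> \<le> 2 ^ ?n" by (rule less_imp_le[OF less_exp])
    finally have "u i ^ (2 ^ ?n) = u i ^ (2 ^ ?n - N i) * u i ^ N i" by (simp flip: power_add)
    then show "u i ^ (2 ^ ?n) \<in> ideal.span S" using ideal.span_scale[OF N[OF i]] by simp
  qed
qed

text \<open>\<open>syz\<close> is used twice: on the cocycle condition, to make \<kappa> a
  coboundary, and on the cochain \<open>q ^ m * A i ^ 2\<close> corrected by multiples of \<delta>,
  to extend it. The residual \<open>x 3\<close> term is harmless, since the result is applied only
  where \<open>x 3\<close> vanishes.\<close>

lemma cocycle_descent:
  fixes A B x :: "3 \<Rightarrow> 'a::comm_ring_1"
  assumes char: "\<And>z :: 'a. z + z = 0"
    and AB: "\<And>i j. A i * B j - c i j * \<delta> \<in> ideal.span T"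
    and x: "\<And>i. x i = A i + B i"
    and syz: "\<And>c :: 3 \<Rightarrow> 'a. (\<Sum>i\<in>UNIV. c i * x i ^ 2) \<in> ideal.span T \<Longrightarrow>
      \<exists>m. \<forall>i. q ^ m * c i \<in> ideal.span ((\<lambda>j. x j ^ 2) ` (UNIV - {i}) \<union> T)"
  shows "\<exists>m \<beta> e e'. q ^ m * A 1 ^ 2 - \<beta> * \<delta> - e * x 1 ^ 2 - e' * x 3 ^ 2 \<in> ideal.span T"
proof -
  note Imul = ideal.span_scale[of _ T] and Isub = ideal.span_diff[of _ T]
  define \<kappa> where "\<kappa> i j = A i * B j * c i j + A j * B i * c j i" for i j
  note cc = cocycle[OF ideal.subspace_span char AB x, folded \<kappa>_def]
  have neq: "(1 :: 3) \<noteq> 2" "(1 :: 3) \<noteq> 3" "(2 :: 3) \<noteq> 3" "(2 :: 3) \<noteq> 1" "(3 :: 3) \<noteq> 1" "(3 :: 3) \<noteq> 2"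
    by simp_all
  have sets: "UNIV - {3 :: 3} = {2, 1}" "UNIV - {2 :: 3} = {3, 1}"
    unfolding UNIV_3 using neq by auto
  \<comment> \<open>Each \<kappa> is paired with the square of the \<open>x\<close> of the missing
    index, as in the cocycle condition.\<close>
  let ?c = "\<lambda>i. if i = 3 then \<kappa> 1 2 else if i = 2 then \<kappa> 1 3 else \<kappa> 2 3"
  have "(\<Sum>i\<in>UNIV. ?c i * x i ^ 2) \<in> ideal.span T"
    using cc(1)[where i = 1 and j = 2 and k = 3] neq by (simp add: sum_3 add_ac)
  from syz[of ?c, OF this] obtain m
    where "\<forall>i. q ^ m * ?c i \<in> ideal.span ((\<lambda>j. x j ^ 2) ` (UNIV - {i}) \<union> T)" ..
  then have "q ^ m * \<kappa> 1 2 \<in> ideal.span ((\<lambda>j. x j ^ 2) ` (UNIV - {3}) \<union> T)"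
    by (rule allE[of _ 3]) simp
  then obtain \<alpha> \<beta> where \<alpha>\<beta>: "q ^ m * \<kappa> 1 2 - \<beta> * x 2 ^ 2 - \<alpha> * x 1 ^ 2 \<in> ideal.span T"
    unfolding sets by (auto simp: ideal.span_breakdown_eq)
  \<comment> \<open>Multiplying the formula for \<kappa> by \<delta> and inserting the coboundary
    relation gives a syzygy of \<open>x 1 ^ 2\<close> and \<open>x 2 ^ 2\<close> with these
    coefficients.\<close>
  let ?d = "\<lambda>i. if i = 1 then q ^ m * A 2 ^ 2 - \<alpha> * \<delta> else if i = 2 then q ^ m * A 1 ^ 2 - \<beta> * \<delta> else 0"
  have "\<delta> * (q ^ m * \<kappa> 1 2 - \<beta> * x 2 ^ 2 - \<alpha> * x 1 ^ 2)
      - q ^ m * (\<kappa> 1 2 * \<delta> - (A 1 ^ 2 * x 2 ^ 2 + A 2 ^ 2 * x 1 ^ 2)) \<in> ideal.span T"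
    by (rule Isub[OF Imul[OF \<alpha>\<beta>] Imul[OF cc(2)]])
  also have "\<delta> * (q ^ m * \<kappa> 1 2 - \<beta> * x 2 ^ 2 - \<alpha> * x 1 ^ 2)
      - q ^ m * (\<kappa> 1 2 * \<delta> - (A 1 ^ 2 * x 2 ^ 2 + A 2 ^ 2 * x 1 ^ 2)) = (\<Sum>i\<in>UNIV. ?d i * x i ^ 2)"
    using neq by (simp add: sum_3 algebra_simps)
  finally have "(\<Sum>i\<in>UNIV. ?d i * x i ^ 2) \<in> ideal.span T" .
  from syz[of ?d, OF this] obtain m'
    where "\<forall>i. q ^ m' * ?d i \<in> ideal.span ((\<lambda>j. x j ^ 2) ` (UNIV - {i}) \<union> T)" ..
  then have "q ^ m' * (q ^ m * A 1 ^ 2 - \<beta> * \<delta>) \<in> ideal.span ((\<lambda>j. x j ^ 2) ` (UNIV - {2}) \<union> T)"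
    by (rule allE[of _ 2]) simp
  then obtain e e' where "q ^ m' * (q ^ m * A 1 ^ 2 - \<beta> * \<delta>) - e' * x 3 ^ 2 - e * x 1 ^ 2 \<in> ideal.span T"
    unfolding sets by (auto simp: ideal.span_breakdown_eq)
  also have "q ^ m' * (q ^ m * A 1 ^ 2 - \<beta> * \<delta>) - e' * x 3 ^ 2 - e * x 1 ^ 2
      = q ^ (m' + m) * A 1 ^ 2 - (q ^ m' * \<beta>) * \<delta> - e * x 1 ^ 2 - e' * x 3 ^ 2"
    by (simp add: power_add algebra_simps)
  finally show ?thesis by blast
qed

text \<open>
  The pairs \<open>(w, v)\<close> with \<open>v\<close> in the slice \<open>(1 + l 1, 1 + l 2, 1 + l 3, 1, 0, 0, 0)\<close> form an affine space
  with coordinate ring \<open>k[7 + 3]\<close>: the coordinates \<open>Inl\<close> are those of \<open>w - v0\<close>, the coordinates \<open>Inr\<close> are the \<open>l i\<close>.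
  In it the pairs in a common orbit form a union of 3-dimensional affine subspaces. The two through the
  origin, \<open>w = v\<close> and \<open>w = \<sigma> v\<close> with \<open>\<sigma> = (1, 1, 1, 1)\<close>, meet only there.
\<close>

lemma eight_invariants_do_not_separate:
  fixes h :: "8 \<Rightarrow> ('k::alg_closed_field, 7) mpoly"
  assumes char: "CHAR('k) = 2"
    and inv: "\<And>j a v. peval (h j) (act a v) = peval (h j) v"
    and sep: "\<And>v w. (\<And>j. peval (h j) v = peval (h j) w) \<Longrightarrow> \<exists>a. v = act a w"
  shows False
proof -
  note char' = mpoly_char_2_add_self[OF char]
  define v0 :: "'k ^ 7" where "v0 = vector [1, 1, 1, 1, 0, 0, 0]"
  have fibres: "finite {w. \<forall>j. peval (h j) w = peval (h j) v}" for v
  proof (rule finite_subset)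
    show "{w. \<forall>j. peval (h j) w = peval (h j) v} \<subseteq> range (\<lambda>a. act a v)" using sep by blast
  qed (intro finite_imageI finite_bit_vec)
  then obtain s \<theta> c where \<theta>: "\<And>j. h j = \<theta> j + Const (c j) * h s"
    and fin: "finite {w. \<forall>j. j \<noteq> s \<longrightarrow> peval (\<theta> j) w = peval (\<theta> j) v0}"
    using finite_fibre_projection[of h v0, OF _ fibres] by auto
  have \<theta>_eq: "peval (\<theta> j) v = peval (\<theta> j) w" if "\<And>j. peval (h j) v = peval (h j) w" for j v w
    using that[of j] that[of s] arg_cong[OF \<theta>[of j], of "\<lambda>p. peval p v"] arg_cong[OF \<theta>[of j], of "\<lambda>p. peval p w"]
    by simp

  define vp :: "'k ^ (7 + 3) \<Rightarrow> 'k ^ 7" where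
    "vp z = vector [1 + z $ Inr 1, 1 + z $ Inr 2, 1 + z $ Inr 3, 1, 0, 0, 0]" for z
  define wp :: "'k ^ (7 + 3) \<Rightarrow> 'k ^ 7" where "wp z = (\<chi> i. v0 $ i + z $ Inl i)" for z
  define V :: "('k, 7 + 3) mpoly ^ 7" where
    "V = vector [1 + X (Inr 1), 1 + X (Inr 2), 1 + X (Inr 3), 1, 0, 0, 0]"
  define W :: "7 \<Rightarrow> ('k, 7 + 3) mpoly" where "W i = Const (v0 $ i) + X (Inl i)" for i
  have V: "(\<chi> i. peval (V $ i) z) = vp z" for z
    by (simp add: vec_eq_iff forall_7 V_def vp_def)
  have W: "peval (W i) z = wp z $ i" for i z
    by (simp add: W_def wp_def)
  define D where "D p = poly_subst Const W p - poly_subst Const (\<lambda>i. V $ i) p" for p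
  have D: "peval (D p) z = peval p (wp z) - peval p (vp z)" for p z
    by (simp add: D_def peval_poly_subst V W)
  \<comment> \<open>The seven equations meant to be regular; the eighth, \<open>D (h s)\<close>, is
    the \<delta> of the cocycle argument.\<close>
  define T where "T = (\<lambda>j. D (\<theta> j)) ` (UNIV - {s})"
  have common: "peval (h j) (wp z) = peval (h j) (vp z)" if "\<And>p. p \<in> insert (D (h s)) T \<Longrightarrow> peval p z = 0" for j z
  proof -
    have s: "peval (h s) (wp z) = peval (h s) (vp z)" using that[of "D (h s)"] by (simp add: D)
    show ?thesis
    proof (cases "j = s")
      case False
      then have "peval (\<theta> j) (wp z) = peval (\<theta> j) (vp z)" using that[of "D (\<theta> j)"] by (auto simp: D T_def)
      then show ?thesis
        using s arg_cong[OF \<theta>[of j], of "\<lambda>p. peval p (wp z)"] arg_cong[OF \<theta>[of j], of "\<lambda>p. peval p (vp z)"] by simp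
    qed (use s in simp)
  qed
  have T_zero: "peval p z = 0" if "wp z = act a (vp z)" "p \<in> insert (D (h s)) T" for p z a
    using that(2) \<theta>_eq[of "wp z" "vp z"] by (auto simp: T_def D that(1) inv)

  define xi :: "3 \<Rightarrow> 7" where "xi i = vector [1, 2, 3] $ i" for i
  define yi :: "3 \<Rightarrow> 7" where "yi i = vector [5, 6, 7] $ i" for i
  \<comment> \<open>If \<open>w\<close> is the image of a slice point under \<alpha>, its
    \<open>yi i\<close> coordinate is \<open>\<alpha> $ i\<close> times its \<open>xi i\<close>
    coordinate, plus \<open>\<alpha> $ 4\<close>. Hence \<open>a i\<close> is 0 for
    \<open>\<alpha> $ 4 = 0\<close> and \<open>X (Inr i)\<close> for
    \<open>\<alpha> $ 4 = 1\<close>: the quotient of \<open>a i\<close> by \<open>X (Inr i)\<close>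
    is the idempotent separating the two classes.\<close>
  define a where "a i = W (yi i) ^ 2 + W (xi i) * W (yi i)" for i
  define b where "b i = a i + X (Inr i)" for i
  have a: "peval (a i) z = (wp z $ yi i) ^ 2 + wp z $ xi i * wp z $ yi i" for i z
    by (simp add: a_def W)
  have b: "peval (b i) z = peval (a i) z + z $ Inr i" for i z
    by (simp add: b_def)
  have ab: "peval (a i * b j) z = 0" if z: "\<And>p. p \<in> insert (D (h s)) T \<Longrightarrow> peval p z = 0" for i j z
  proof -
    obtain \<alpha> where \<alpha>: "wp z = act \<alpha> (vp z)" using sep[OF common[OF z]] by blast
    have "\<forall>i. (\<alpha> $ 4 = 0 \<longrightarrow> peval (a i) z = 0) \<and> (\<alpha> $ 4 = 1 \<longrightarrow> peval (b i) z = 0)"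
      unfolding forall_3 b a \<alpha>
      by (simp add: xi_def yi_def act_def vp_def power2_eq_square algebra_simps char_2_two[OF char])
    then show ?thesis by (cases "\<alpha> $ 4") auto
  qed
  obtain n where n: "(a (fst ij) * b (snd ij)) ^ (2 ^ n) \<in> ideal.span (insert (D (h s)) T)" for ij
    using nullstellensatz_uniform[of UNIV "insert (D (h s)) T" "\<lambda>ij. a (fst ij) * b (snd ij)"] ab by auto
  define A B x where "A i = a i ^ 2 ^ n" and "B i = b i ^ 2 ^ n" and "x i = (X (Inr i) :: ('k, 7 + 3) mpoly) ^ 2 ^ n" for i
  have x_eq: "x i = A i + B i" for i
  proof -
    have "A i + B i = (A i + A i) + x i"
      unfolding A_def B_def x_def b_def power_two_power_add[OF char'] by (simp only: add.assoc)
    then show ?thesis by (simp only: char' add_0)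
  qed
  have "\<exists>k. A i * B j - k * D (h s) \<in> ideal.span T" for i j
    using n[of "(i, j)"] by (simp add: A_def B_def power_mult_distrib ideal.span_breakdown_eq)
  then obtain cc where AB: "\<And>i j. A i * B j - cc i j * D (h s) \<in> ideal.span T" by metis

  define J where "J = (UNIV - {s}) <+> (UNIV :: 3 set)"
  define f where "f = (\<lambda>j. case j of Inl j \<Rightarrow> D (\<theta> j) | Inr i \<Rightarrow> x i ^ 2)"
  define \<Omega> where "\<Omega> = {w. \<forall>j. j \<noteq> s \<longrightarrow> peval (\<theta> j) w = peval (\<theta> j) v0}"
  have "\<forall>\<omega>. \<exists>i. \<omega> \<noteq> v0 \<longrightarrow> v0 $ i \<noteq> \<omega> $ i" by (metis vec_eq_iff)
  then obtain \<iota> where \<iota>: "\<And>\<omega>. \<omega> \<noteq> v0 \<Longrightarrow> v0 $ \<iota> \<omega> \<noteq> \<omega> $ \<iota> \<omega>" by metis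
  \<comment> \<open>Vanishes at the other points of the finite fibre but not at the origin;
    inverting it isolates the origin.\<close>
  define q0 where "q0 = (\<Prod>\<omega>\<in>\<Omega> - {v0}. W (\<iota> \<omega>) - Const (\<omega> $ \<iota> \<omega>))"
  have wp0: "wp 0 = v0" by (simp add: wp_def vec_eq_iff)
  have fin': "finite (\<Omega> - {v0})" using fin by (simp add: \<Omega>_def)
  have q0_zero: "peval q0 0 \<noteq> 0"
    unfolding q0_def peval.hom_prod prod_zero_iff[OF fin'] using \<iota> by (auto simp: W wp0)
  have "peval (q0 * X i) z = 0" if z: "\<And>p. p \<in> f ` J \<Longrightarrow> peval p z = 0" for i z
  proof -
    have "peval (x i ^ 2) z = 0" for i
      by (rule z) (force simp: f_def J_def)
    then have l: "z $ Inr i = 0" for i by (simp add: x_def)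
    then have vp: "vp z = v0" by (simp add: vp_def v0_def)
    have "peval (D (\<theta> j)) z = 0" if "j \<noteq> s" for j
      by (rule z) (use that in \<open>force simp: f_def J_def\<close>)
    then have "wp z \<in> \<Omega>" by (simp add: \<Omega>_def D vp)
    show ?thesis
    proof (cases "wp z = v0")
      case True
      then have "z $ Inl i = 0" for i by (simp add: wp_def vec_eq_iff)
      then have "z $ i = 0" by (cases i) (simp_all add: l)
      then show ?thesis by simp
    next
      case False
      then have "wp z \<in> \<Omega> - {v0}" using \<open>wp z \<in> \<Omega>\<close> by blast
      then have "peval q0 z = 0"
        unfolding q0_def peval.hom_prod by (intro prod_zero[OF fin'] bexI[of _ "wp z"]) (simp_all add: W)
      then show ?thesis by simp
    qed
  qed
  then obtain N where N: "\<And>i. (q0 * X i) ^ (2 ^ N) \<in> ideal.span (f ` J)"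
    using nullstellensatz_uniform[of UNIV "f ` J" "\<lambda>i. q0 * X i"] by auto
  define q where "q = q0 ^ 2 ^ N"
  have qX: "q * X i ^ 2 ^ N \<in> ideal.span (f ` J)" for i
    using N[of i] by (simp add: q_def power_mult_distrib)
  \<comment> \<open>Seven projected equations and three slice equations: exactly as many as there
    are variables, the limit allowed for the vanishing of Koszul homology.\<close>
  have J: "finite J" "card J \<le> CARD(7 + 3)"
    by (simp_all add: J_def card_Plus)
  have syz: "\<exists>m. \<forall>i. q ^ m * c i \<in> ideal.span ((\<lambda>j. x j ^ 2) ` (UNIV - {i}) \<union> T)"
    if c: "(\<Sum>i\<in>UNIV. c i * x i ^ 2) \<in> ideal.span T" for c
  proof -
    obtain \<mu> where \<mu>: "(\<Sum>i\<in>UNIV. c i * x i ^ 2) = (\<Sum>j\<in>UNIV - {s}. D (\<theta> j) * \<mu> j)"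
      using ideal_span_image[of _ "\<lambda>j. D (\<theta> j)" "UNIV - {s}"] c unfolding T_def by auto
    let ?c = "\<lambda>j. case j of Inl j \<Rightarrow> - \<mu> j | Inr i \<Rightarrow> c i"
    have "(\<Sum>j\<in>J. f j * ?c j) = (\<Sum>j\<in>UNIV - {s}. D (\<theta> j) * (- \<mu> j)) + (\<Sum>i\<in>UNIV. x i ^ 2 * c i)"
      unfolding J_def by (subst sum.Plus) (simp_all add: f_def)
    also have "\<dots> = 0" using \<mu> by (simp add: sum_negf mult.commute)
    finally obtain m where m: "\<forall>j\<in>J. q ^ m * ?c j \<in> ideal.span (f ` (J - {j}))"
      using mpoly_syzygy[OF J char' qX, of ?c] by blast
    have "q ^ m * c i \<in> ideal.span ((\<lambda>j. x j ^ 2) ` (UNIV - {i}) \<union> T)" for i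
    proof -
      have "Inr i \<in> J" by (auto simp: J_def)
      with m have "q ^ m * c i \<in> ideal.span (f ` (J - {Inr i}))" by force
      moreover have "f ` (J - {Inr i}) \<subseteq> (\<lambda>j. x j ^ 2) ` (UNIV - {i}) \<union> T"
        by (auto simp: f_def J_def T_def)
      ultimately show ?thesis using ideal.span_mono by blast
    qed
    then show ?thesis by blast
  qed
  obtain m \<beta> e e' where rel: "q ^ m * A 1 ^ 2 - \<beta> * D (h s) - e * x 1 ^ 2 - e' * x 3 ^ 2 \<in> ideal.span T"
    using cocycle_descent[OF char' AB x_eq syz] by blast
  \<comment> \<open>On pairs in a common orbit all eight equations vanish, and the last coordinate
    removes the \<open>x 3\<close> term.\<close>
  have rel_at: "peval (q ^ m) z * peval (a 1) z ^ (2 * 2 ^ n) = peval e z * (z $ Inr 1) ^ (2 * 2 ^ n)"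
    if z: "wp z = act \<alpha> (vp z)" "z $ Inr 3 = 0" for z \<alpha>
    using peval_zero_span[OF rel, of z] T_zero[OF z(1)] z(2)
    by (simp add: A_def x_def power_mult[symmetric] mult.commute power_0_left)

  \<comment> \<open>Lines in the two graphs over the same line of the slice. On the first
    \<open>a 1\<close> is 0, on the second it equals \<open>X (Inr 1)\<close>, so \<open>e\<close>
    would have both the value 0 and the nonzero value of \<open>q ^ m\<close> at the origin.\<close>
  define d :: "'k ^ (7 + 3)" where "d = (\<chi> k. if k = Inl 1 \<or> k = Inr 1 then 1 else 0)"
  define d' :: "'k ^ (7 + 3)" where "d' = (\<chi> k. if k = Inl 1 \<or> k = Inr 1 \<or> k = Inl 5 then 1 else 0)"
  have "peval e (t *s d) = 0" if t: "t \<noteq> 0" for t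
  proof -
    have "wp (t *s d) = act 0 (vp (t *s d))"
      by (simp add: vec_eq_iff forall_7 wp_def vp_def d_def v0_def)
    moreover have "peval (a 1) (t *s d) = 0"
      by (simp add: a xi_def yi_def wp_def d_def v0_def)
    ultimately show ?thesis using rel_at[of "t *s d" 0] t by (simp add: d_def power_0_left)
  qed
  then have e0: "peval e 0 = 0" by (rule peval_zero_limit)
  have "peval (e - q ^ m) (t *s d') = 0" if t: "t \<noteq> 0" for t
  proof -
    have "wp (t *s d') = act (vector [1, 1, 1, 1]) (vp (t *s d'))"
      by (simp add: vec_eq_iff forall_7 wp_def vp_def d'_def v0_def act_def vector_def char_2_two[OF char])
    moreover have "peval (a 1) (t *s d') = t"
      by (simp add: a xi_def yi_def wp_def d'_def v0_def power2_eq_square algebra_simps char_2_two[OF char])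
    ultimately show ?thesis using rel_at[of "t *s d'"] t by (simp add: d'_def)
  qed
  then have "peval (e - q ^ m) 0 = 0" by (rule peval_zero_limit)
  then show False using e0 q0_zero by (simp add: q_def)
qed

theorem separating_set_card:
  fixes F :: "('k::alg_closed_field, 7) mpoly set"
  assumes char: "CHAR('k) = 2" and F: "separating_set G F" "finite F"
  shows "9 \<le> card F"
proof (rule ccontr)
  assume "\<not> 9 \<le> card F"
  then have "card F \<le> card (UNIV :: 8 set)" by simp
  then obtain f :: "_ \<Rightarrow> 8" where f: "inj_on f F" using card_le_inj[OF F(2) finite] by blast
  \<comment> \<open>Smaller families are padded with the zero polynomial, which is invariant and
    separates nothing.\<close>
  define h where "h j = (if j \<in> f ` F then inv_into F f j else 0)" for j
  have h: "h (f p) = p" if "p \<in> F" for p using that f by (simp add: h_def)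
  have "h j \<in> F \<or> h j = 0" for j by (auto simp: h_def inv_into_into)
  then have "peval (h j) (act a v) = peval (h j) v" for j a v
    using F(1) invariants_G_iff unfolding separating_set_def by (metis peval.hom_0 subsetD)
  moreover have "\<exists>a. v = act a w" if "\<And>j. peval (h j) v = peval (h j) w" for v w
    using separating_setD[OF char F(1)] that h by metis
  ultimately show False by (rule eight_invariants_do_not_separate[OF char])
qed


section \<open>The nine invariants separate\<close>

theorem separating_set_nine:
  fixes f1 f2 f3 g1 g2 g3 r :: "('k::alg_closed_field, 7) mpoly"
  assumes char: "CHAR('k) = 2"
    and gens: "subalgebra {X 1, X 2, X 3, X 4, f1, f2, f3, g1, g2, g3, r} = invariants G"
    and rel_a: "\<And>f. f \<in> {f1, f2, f3} \<Longrightarrow>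
                  f * r \<in> subalgebra {X 1, X 2, X 3, X 4, f1, f2, f3, g1, g2, g3}"
    and rel_b: "cong_mod_ideal (r^2) ((X 1 + X 4)^2 * g2 * g3) {f1, f2, f3}"
    and rel_c: "(X 3 + X 4) * f3 = f2 * (X 2 + X 4) + f1 * (X 1 + X 4)"
    and rel_d: "cong_mod_ideal ((X 2 + X 4)^2 * g3) (f1^2) {X 3 + X 4}"
               "cong_mod_ideal ((X 1 + X 4)^2 * g3) (f2^2) {X 3 + X 4}"
    and rel_e: "cong_mod_ideal f3 0 {X 1 + X 4, X 2 + X 4, X 3 + X 4}"
  shows "separating_set G {X 1, X 2, X 3, X 4, f1, f2, g1, g2, f3 + g3}"
  unfolding separating_set_def
proof (intro conjI allI impI)
  let ?gens = "{X 1, X 2, X 3, X 4, f1, f2, f3, g1, g2, g3, r}"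
  show "{X 1, X 2, X 3, X 4, f1, f2, g1, g2, f3 + g3} \<subseteq> invariants G"
    unfolding gens[symmetric] by (auto intro!: subalgebra.add intro: subalgebra.gen)
  fix v w :: "'k ^ 7"
  assume orbits: "orbit G v \<noteq> orbit G w"
  show "\<exists>h\<in>{X 1, X 2, X 3, X 4, f1, f2, g1, g2, f3 + g3}. peval h v \<noteq> peval h w"
  proof (rule ccontr)
    assume "\<not> ?thesis"
    then have eq: "v $ 1 = w $ 1" "v $ 2 = w $ 2" "v $ 3 = w $ 3" "v $ 4 = w $ 4"
      "peval f1 v = peval f1 w" "peval f2 v = peval f2 w" "peval g1 v = peval g1 w" "peval g2 v = peval g2 w"
      and sum: "peval f3 v + peval g3 v = peval f3 w + peval g3 w"
      by simp_all
    have c: "(u $ 3 + u $ 4) * peval f3 u = peval f2 u * (u $ 2 + u $ 4) + peval f1 u * (u $ 1 + u $ 4)" for u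
      using arg_cong[OF rel_c, of "\<lambda>p. peval p u"] by simp
    have d: "(u $ 2 + u $ 4)^2 * peval g3 u = (peval f1 u)^2" "(u $ 1 + u $ 4)^2 * peval g3 u = (peval f2 u)^2"
      if "u $ 3 + u $ 4 = 0" for u
      using cong_mod_ideal_peval[OF rel_d(1), of u] cong_mod_ideal_peval[OF rel_d(2), of u] that by simp_all
    have "peval f3 v = peval f3 w \<or> peval g3 v = peval g3 w"
    proof (cases "w $ 3 + w $ 4 = 0")
      case False
      have "(w $ 3 + w $ 4) * peval f3 v = (w $ 3 + w $ 4) * peval f3 w"
        using c[of v] c[of w] by (simp add: eq)
      then show ?thesis using False by simp
    next
      case 3: True
      consider "w $ 2 + w $ 4 \<noteq> 0" | "w $ 1 + w $ 4 \<noteq> 0" | "w $ 2 + w $ 4 = 0" "w $ 1 + w $ 4 = 0" by blast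
      then show ?thesis
      proof cases
        case 1
        have "(w $ 2 + w $ 4)^2 * peval g3 v = (w $ 2 + w $ 4)^2 * peval g3 w"
          using d(1)[of v] d(1)[of w] 3 by (simp add: eq)
        then show ?thesis using 1 by simp
      next
        case 2
        have "(w $ 1 + w $ 4)^2 * peval g3 v = (w $ 1 + w $ 4)^2 * peval g3 w"
          using d(2)[of v] d(2)[of w] 3 by (simp add: eq)
        then show ?thesis using 2 by simp
      next
        case _: 3
        then have "peval f3 u = 0" if "u = v \<or> u = w" for u
          using cong_mod_ideal_peval[OF rel_e, of u] 3 that eq by force
        then show ?thesis by simp
      qed
    qed
    then have f3: "peval f3 v = peval f3 w" and g3: "peval g3 v = peval g3 w"
      using sum by auto
    have r: "peval r v = peval r w"
    proof (cases "\<exists>f\<in>{f1, f2, f3}. peval f w \<noteq> 0")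
      case True
      then obtain f where f: "f \<in> {f1, f2, f3}" "peval f w \<noteq> 0" by blast
      then have "peval f v = peval f w" using eq f3 by auto
      moreover have "peval (f * r) v = peval (f * r) w"
        by (rule subalgebra_peval_eq[OF rel_a[OF f(1)]]) (use eq f3 g3 in auto)
      ultimately show ?thesis using f(2) by simp
    next
      case False
      then have "(peval r u)^2 = (u $ 1 + u $ 4)^2 * peval g2 u * peval g3 u" if "u = v \<or> u = w" for u
        using cong_mod_ideal_peval[OF rel_b, of u] that eq f3 by force
      from this[of v] this[of w] have "(peval r v)^2 = (peval r w)^2"
        using eq g3 by simp
      then have "(peval r v + peval r w)^2 = 0"
        using char_2_two[OF char] by (simp add: power2_sum)
      then have "peval r v = - peval r w" by (simp add: add_eq_0_iff2)
      also have "\<dots> = peval r w" using char_2_add_self[OF char, of "peval r w"] by (simp add: add_eq_0_iff2)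
      finally show ?thesis .
    qed
    have "peval p v = peval p w" if "p \<in> invariants G" for p
      using that unfolding gens[symmetric]
      by (rule subalgebra_peval_eq) (use eq f3 g3 r in auto)
    then obtain a where "v = act a w" using invariants_separate_orbits[OF char] by blast
    then show False using orbit_G_eq[OF char, of v a w] orbits by simp
  qed
qed

theorem proposition5p4:
  fixes f1 f2 f3 g1 g2 g3 r :: "('k::alg_closed_field, 7) mpoly"
  assumes char: "CHAR('k) = 2"
    and gens: "minimal_generating_set (invariants G)
                 {X 1, X 2, X 3, X 4, f1, f2, f3, g1, g2, g3, r}"
    and deg_f: "homogeneous 3 f1" "homogeneous 3 f2" "homogeneous 3 f3"
    and deg_g: "homogeneous 4 g1" "homogeneous 4 g2" "homogeneous 4 g3"
    and deg_r: "homogeneous 5 r"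
    and rel_a: "\<forall>f\<in>{f1, f2, f3}.
                  f * r \<in> subalgebra {X 1, X 2, X 3, X 4, f1, f2, f3, g1, g2, g3}"
    and rel_b: "cong_mod_ideal (r^2) ((X 1 + X 4)^2 * g2 * g3) {f1, f2, f3}"
    and rel_c: "(X 3 + X 4) * f3 = f2 * (X 2 + X 4) + f1 * (X 1 + X 4)"
    and rel_d: "cong_mod_ideal ((X 2 + X 4)^2 * g3) (f1^2) {X 3 + X 4}"
               "cong_mod_ideal ((X 1 + X 4)^2 * g3) (f2^2) {X 3 + X 4}"
    and rel_e: "cong_mod_ideal f3 0 {X 1 + X 4, X 2 + X 4, X 3 + X 4}"
  shows "separating_set_of_minimal_size G {X 1, X 2, X 3, X 4, f1, f2, g1, g2, f3 + g3}"
proof -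
  let ?E = "{X 1, X 2, X 3, X 4, f1, f2, g1, g2, f3 + g3}"
  have "separating_set G ?E"
    using gens rel_a by (intro separating_set_nine[OF char _ _ rel_b rel_c rel_d rel_e])
      (auto simp: minimal_generating_set_def)
  \<comment> \<open>An upper bound is enough here, because every finite separating set has at least
    9 elements.\<close>
  moreover have "card ?E \<le> 9"
    using card_length[of "[X 1, X 2, X 3, X 4, f1, f2, g1, g2, f3 + g3]"] by simp
  ultimately show ?thesis
    unfolding separating_set_of_minimal_size_def using separating_set_card[OF char] by fastforce
qed

end
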